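(* Let $A$ be as in the context. If $A$ is normal and $d\le 3$, then there exists a generic cost vector $c\in\mathbb Z^n$ such that $IP_{A,c}$ is a Gomory family.
   Context: $A\in\mathbb Z^{d\times n}$ has rank $d$, columns $a_1,\dots,a_n$, $cone(A)$ pointed, $\{x\in\mathbb R^n_{\ge0}:Ax=0\}=\{0\}$, $\mathbb ZA=\mathbb Z^d$, $\mathbb NA=\{Au:u\in\mathbb N^n\}$. $A$ is normal if $\mathbb NA=cone(A)\cap\mathbb Z^d$. For $c\in\mathbb R^n$, $\Delta_c$ is the collection of $\sigma\subseteq\{1,\dots,n\}$ for which some $y\in\mathbb R^d$ has $y\cdot a_j=c_j$ ($j\in\sigma$), $y\cdot a_j<c_j$ ($j\notin\sigma$). A cost vector $c$ is generic if $\Delta_c$ is a triangulation of $cone(A)$ and every program $IP_{A,c}(b)=\min\{c\cdot x: Ax=b,\ x\in\mathbb N^n\}$, $b\in\mathbb NA$, has a unique optimal solution; $IP_{A,c}$ is the family of these programs. For a maximal face $\sigma$ of $\Delta_c$ let $\tilde c_{\bar\sigma}=c_{\bar\sigma}-c_\sigma A_\sigma^{-1}A_{\bar\sigma}$; the group relaxation $G^\sigma(b)$ is $\min\{\tilde c_{\bar\sigma}\cdot x_{\bar\sigma}: A_\sigma x_\sigma+A_{\bar\sigma}x_{\bar\sigma}=b,\ x_{\bar\sigma}\ge0,\ x\in\mathbb Z^n\}$, which solves $IP_{A,c}(b)$ if its optimal solution is non-negative. $IP_{A,c}$ is a Gomory family if for every $b\in\mathbb NA$ some maximal face $\sigma$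 of $\Delta_c$ has $G^\sigma(b)$ solving $IP_{A,c}(b)$. *)

theory Defs
  imports Complex_Main
begin

text \<open>Conventions. The matrix A in Z^{d x n} is a function A :: nat => nat => int,
  entry (i,j) for i < d, j < n; column j is a_j. Vectors of R^d (resp. R^n) are functions
  nat => real, only the coordinates below d (resp. n) being relevant. Columns are indexed
  by 0..n-1 instead of 1..n.\<close>

definition colprod :: "(nat \<Rightarrow> nat \<Rightarrow> int) \<Rightarrow> nat \<Rightarrow> (nat \<Rightarrow> real) \<Rightarrow> nat \<Rightarrow> real" where
  "colprod A d y j = (\<Sum>i<d. y i * real_of_int (A i j))"

definition matvec_real :: "(nat \<Rightarrow> nat \<Rightarrow> int) \<Rightarrow> nat \<Rightarrow> nat set \<Rightarrow> (nat \<Rightarrow> real) \<Rightarrow> nat \<Rightarrow> real" where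
  "matvec_real A d S x = (\<lambda>i. if i < d then (\<Sum>j\<in>S. real_of_int (A i j) * x j) else 0)"

definition cone_of :: "(nat \<Rightarrow> nat \<Rightarrow> int) \<Rightarrow> nat \<Rightarrow> nat set \<Rightarrow> (nat \<Rightarrow> real) set" where
  "cone_of A d S = {v. \<exists>x. (\<forall>j\<in>S. 0 \<le> x j) \<and> v = matvec_real A d S x}"

definition full_row_rank :: "(nat \<Rightarrow> nat \<Rightarrow> int) \<Rightarrow> nat \<Rightarrow> nat \<Rightarrow> bool" where
  "full_row_rank A d n \<longleftrightarrow> (\<forall>y. (\<forall>j<n. colprod A d y j = 0) \<longrightarrow> (\<forall>i<d. y i = 0))"

definition pointed_cone :: "(nat \<Rightarrow> nat \<Rightarrow> int) \<Rightarrow> nat \<Rightarrow> nat \<Rightarrow> bool" where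
  "pointed_cone A d n \<longleftrightarrow>
     (\<forall>v. v \<in> cone_of A d {..<n} \<and> (\<lambda>i. - v i) \<in> cone_of A d {..<n} \<longrightarrow> (\<forall>i. v i = 0))"

definition lattice_full :: "(nat \<Rightarrow> nat \<Rightarrow> int) \<Rightarrow> nat \<Rightarrow> nat \<Rightarrow> bool" where
  "lattice_full A d n \<longleftrightarrow>
     (\<forall>b :: nat \<Rightarrow> int. \<exists>u :: nat \<Rightarrow> int. \<forall>i<d. (\<Sum>j<n. A i j * u j) = b i)"

definition in_NA :: "(nat \<Rightarrow> nat \<Rightarrow> int) \<Rightarrow> nat \<Rightarrow> nat \<Rightarrow> (nat \<Rightarrow> int) \<Rightarrow> bool" where
  "in_NA A d n b \<longleftrightarrow> (\<exists>u :: nat \<Rightarrow> nat. \<forall>i<d. (\<Sum>j<n. A i j * int (u j)) = b i)"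

definition normal_config :: "(nat \<Rightarrow> nat \<Rightarrow> int) \<Rightarrow> nat \<Rightarrow> nat \<Rightarrow> bool" where
  "normal_config A d n \<longleftrightarrow>
     (\<forall>b :: nat \<Rightarrow> int. in_NA A d n b \<longleftrightarrow>
        (\<exists>v\<in>cone_of A d {..<n}. \<forall>i<d. v i = real_of_int (b i)))"

definition Delta :: "(nat \<Rightarrow> nat \<Rightarrow> int) \<Rightarrow> nat \<Rightarrow> nat \<Rightarrow> (nat \<Rightarrow> real) \<Rightarrow> nat set set" where
  "Delta A d n c = {\<sigma>. \<sigma> \<subseteq> {..<n} \<and>
     (\<exists>y. \<forall>j<n. (j \<in> \<sigma> \<longrightarrow> colprod A d y j = c j) \<and> (j \<notin> \<sigma> \<longrightarrow> colprod A d y j < c j))}"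

definition lin_indep_cols :: "(nat \<Rightarrow> nat \<Rightarrow> int) \<Rightarrow> nat \<Rightarrow> nat set \<Rightarrow> bool" where
  "lin_indep_cols A d \<sigma> \<longleftrightarrow>
     (\<forall>x. (\<forall>i<d. (\<Sum>j\<in>\<sigma>. real_of_int (A i j) * x j) = 0) \<longrightarrow> (\<forall>j\<in>\<sigma>. x j = 0))"

text \<open>Triangulation of cone(A): {cone(A_sigma)} is the set of cones of a simplicial fan
  with support cone(A).\<close>
definition is_triangulation :: "(nat \<Rightarrow> nat \<Rightarrow> int) \<Rightarrow> nat \<Rightarrow> nat \<Rightarrow> nat set set \<Rightarrow> bool" where
  "is_triangulation A d n \<Delta> \<longleftrightarrow>
     (\<forall>\<sigma>\<in>\<Delta>. \<sigma> \<subseteq> {..<n} \<and> lin_indep_cols A d \<sigma>) \<and>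
     (\<forall>\<sigma>\<in>\<Delta>. \<forall>\<tau>. \<tau> \<subseteq> \<sigma> \<longrightarrow> \<tau> \<in> \<Delta>) \<and>
     (\<forall>\<sigma>\<in>\<Delta>. \<forall>\<tau>\<in>\<Delta>. cone_of A d \<sigma> \<inter> cone_of A d \<tau> = cone_of A d (\<sigma> \<inter> \<tau>)) \<and>
     (\<Union>\<sigma>\<in>\<Delta>. cone_of A d \<sigma>) = cone_of A d {..<n}"

definition ip_feasible :: "(nat \<Rightarrow> nat \<Rightarrow> int) \<Rightarrow> nat \<Rightarrow> nat \<Rightarrow> (nat \<Rightarrow> int) \<Rightarrow> (nat \<Rightarrow> nat) \<Rightarrow> bool" where
  "ip_feasible A d n b u \<longleftrightarrow>
     (\<forall>j\<ge>n. u j = 0) \<and> (\<forall>i<d. (\<Sum>j<n. A i j * int (u j)) = b i)"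

definition ip_optimal :: "(nat \<Rightarrow> nat \<Rightarrow> int) \<Rightarrow> nat \<Rightarrow> nat \<Rightarrow> (nat \<Rightarrow> real) \<Rightarrow> (nat \<Rightarrow> int) \<Rightarrow> (nat \<Rightarrow> nat) \<Rightarrow> bool" where
  "ip_optimal A d n c b u \<longleftrightarrow> ip_feasible A d n b u \<and>
     (\<forall>v. ip_feasible A d n b v \<longrightarrow> (\<Sum>j<n. c j * real (u j)) \<le> (\<Sum>j<n. c j * real (v j)))"

definition generic_cost :: "(nat \<Rightarrow> nat \<Rightarrow> int) \<Rightarrow> nat \<Rightarrow> nat \<Rightarrow> (nat \<Rightarrow> real) \<Rightarrow> bool" where
  "generic_cost A d n c \<longleftrightarrow> is_triangulation A d n (Delta A d n c) \<and>
     (\<forall>b. in_NA A d n b \<longrightarrow> (\<exists>!u. ip_optimal A d n c b u))"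

definition maximal_face :: "nat set set \<Rightarrow> nat set \<Rightarrow> bool" where
  "maximal_face \<Delta> \<sigma> \<longleftrightarrow> \<sigma> \<in> \<Delta> \<and> \<not> (\<exists>\<tau>\<in>\<Delta>. \<sigma> \<subset> \<tau>)"

text \<open>The row vector c_sigma A_sigma^{-1}, i.e. the unique y in R^d with y . a_j = c_j for j in sigma.\<close>
definition dual_sigma :: "(nat \<Rightarrow> nat \<Rightarrow> int) \<Rightarrow> nat \<Rightarrow> (nat \<Rightarrow> real) \<Rightarrow> nat set \<Rightarrow> nat \<Rightarrow> real" where
  "dual_sigma A d c \<sigma> = (THE y. (\<forall>i\<ge>d. y i = 0) \<and> (\<forall>j\<in>\<sigma>. colprod A d y j = c j))"

definition reduced_cost :: "(nat \<Rightarrow> nat \<Rightarrow> int) \<Rightarrow> nat \<Rightarrow> (nat \<Rightarrow> real) \<Rightarrow> nat set \<Rightarrow> nat \<Rightarrow> real" where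
  "reduced_cost A d c \<sigma> j = c j - colprod A d (dual_sigma A d c \<sigma>) j"

definition group_feasible :: "(nat \<Rightarrow> nat \<Rightarrow> int) \<Rightarrow> nat \<Rightarrow> nat \<Rightarrow> nat set \<Rightarrow> (nat \<Rightarrow> int) \<Rightarrow> (nat \<Rightarrow> int) \<Rightarrow> bool" where
  "group_feasible A d n \<sigma> b x \<longleftrightarrow>
     (\<forall>j\<ge>n. x j = 0) \<and> (\<forall>j<n. j \<notin> \<sigma> \<longrightarrow> 0 \<le> x j) \<and>
     (\<forall>i<d. (\<Sum>j<n. A i j * x j) = b i)"

definition group_obj :: "(nat \<Rightarrow> nat \<Rightarrow> int) \<Rightarrow> nat \<Rightarrow> nat \<Rightarrow> (nat \<Rightarrow> real) \<Rightarrow> nat set \<Rightarrow> (nat \<Rightarrow> int) \<Rightarrow> real" where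
  "group_obj A d n c \<sigma> x = (\<Sum>j\<in>{..<n} - \<sigma>. reduced_cost A d c \<sigma> j * real_of_int (x j))"

definition group_optimal :: "(nat \<Rightarrow> nat \<Rightarrow> int) \<Rightarrow> nat \<Rightarrow> nat \<Rightarrow> (nat \<Rightarrow> real) \<Rightarrow> nat set \<Rightarrow> (nat \<Rightarrow> int) \<Rightarrow> (nat \<Rightarrow> int) \<Rightarrow> bool" where
  "group_optimal A d n c \<sigma> b x \<longleftrightarrow> group_feasible A d n \<sigma> b x \<and>
     (\<forall>x'. group_feasible A d n \<sigma> b x' \<longrightarrow> group_obj A d n c \<sigma> x \<le> group_obj A d n c \<sigma> x')"

definition group_solves :: "(nat \<Rightarrow> nat \<Rightarrow> int) \<Rightarrow> nat \<Rightarrow> nat \<Rightarrow> (nat \<Rightarrow> real) \<Rightarrow> nat set \<Rightarrow> (nat \<Rightarrow> int) \<Rightarrow> bool" where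
  "group_solves A d n c \<sigma> b \<longleftrightarrow> (\<exists>x. group_optimal A d n c \<sigma> b x \<and> (\<forall>j<n. 0 \<le> x j))"

definition gomory_family :: "(nat \<Rightarrow> nat \<Rightarrow> int) \<Rightarrow> nat \<Rightarrow> nat \<Rightarrow> (nat \<Rightarrow> real) \<Rightarrow> bool" where
  "gomory_family A d n c \<longleftrightarrow>
     (\<forall>b. in_NA A d n b \<longrightarrow> (\<exists>\<sigma>. maximal_face (Delta A d n c) \<sigma> \<and> group_solves A d n c \<sigma> b))"

end

theory Submission
  imports Defs "HOL-Analysis.Analysis"
begin

text \<open>It suffices to find an integral cost \<open>c\<close> whose triangulation is unimodular: then every linear
  relaxation has an integral optimum, which is its only optimal solution and also solves the group
  relaxation of each maximal face containing its support.

  The columns are first weighted by \<open>-1\<close> plus a small multiple of the squared norm, which triangulates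
  the boundary of the convex hull of the non-zero lattice points of the cone with all lattice points on
  it as vertices. A lattice point in the half-open parallelepiped of a non-unimodular cone then has
  height strictly between 1 and 2, hence is irreducible and, by normality, a column. By White's lemma
  on empty tetrahedra, two coordinates of these points always sum to 1. Star subdivisions at such
  points, the lowest one first, preserve this property, and they end in a unimodular triangulation.\<close>

subsection \<open>Empty tetrahedra\<close>

text \<open>Fans are never manipulated directly. The dual polyhedron of all \<open>y\<close> with
  \<open>y . a_j <= c_j\<close> stands for the triangulation: its sets of tight columns are the
  faces, and a star subdivision is the lowering of a single entry of \<open>c\<close>. Every
  triangulation met is thus of the form \<open>Delta_c\<close> by construction, and as all entries
  stay rational, a positive multiple of the last cost is integral.

  Dimension three enters twice. A fractional point and its complement both have height above 1, and
  their heights sum to at most 3, which leaves no room for a vanishing coordinate. And White's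
  lemma, a statement about three coordinates, provides an edge \<open>u v\<close> with
  \<open>x u + x v = 1\<close> for all fractional points \<open>x\<close> of a cone. "Lowest" then
  refers to the coordinate at the opposite vertex \<open>e\<close>: after subdividing at the lowest
  point, the coordinates of new fractional points cannot wrap around modulo 1, so these points are
  old ones. The process ends because the number of columns that occur as fractional points
  decreases.\<close>

lemma div_mod_step:
  fixes q :: nat
  assumes "w < q"
  shows "(k * q + w) div q = k" "(k * q + w) mod q = w"
  using assms by auto

text \<open>The step functions k b div q and k c div q jump at disjoint times, whose union is the set of jump
  times of k (b + c - 1) div q. A jump of the slower function has a jump of the faster one on either
  side, and these two are too close together for a slope below one half.\<close>
lemma div_split_False:
  fixes q b c :: nat
  assumes split: "\<And>k. k < q \<Longrightarrow> k * b div q + k * c div q = k * (b + c - 1) div q"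
    and small: "2 * (b + c - 1) < q"
    and bmod: "\<And>k. 1 \<le> k \<Longrightarrow> k < q \<Longrightarrow> k * b mod q \<noteq> 0"
    and bc: "2 \<le> c" "c \<le> b"
  shows False
proof -
  define a where "a = b + c - 1"
  have q: "q > 0" "c < q" "b < q" "3 \<le> q" using small bc by auto
  have N: "k * b div q + k * c div q = k * a div q" if "k < q" for k
    using split[OF that] by (simp add: a_def)
  \<comment> \<open>\<open>s\<close> is the first jump of the slower function. Below,
    \<open>s'\<close> and \<open>t\<close> are the jumps of the faster one just before and just
    after it, its \<open>p\<close>-th and its \<open>(p + 1)\<close>-st.\<close>
  define s where "s = (LEAST k. q \<le> k * c)"
  have ex: "q \<le> q * c" using bc by simp
  have s1: "q \<le> s * c" unfolding s_def by (rule LeastI[of "\<lambda>k. q \<le> k * c", OF ex])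
  have s2: "k * c < q" if "k < s" for k
    using not_less_Least[of k "\<lambda>k. q \<le> k * c"] that by (auto simp: s_def)
  have spos: "s > 1" using s1 q by (cases "s = 0"; cases "s = 1") auto
  have sc: "(s - 1) * c < q" using s2[of "s - 1"] spos by auto
  have "(s - 1) * 2 \<le> (s - 1) * c" using bc by (intro mult_le_mono) auto
  then have s3: "2 * s \<le> q + 1" using sc by linarith
  then have sq: "s < q" using q by linarith
  have sc1: "s * c div q = 1"
  proof -
    have "s * c = (s - 1) * c + c" using spos by (simp add: algebra_simps diff_mult_distrib)
    then have "s * c < 2 * q" using sc q by linarith
    then show ?thesis using s1 q by (simp add: div_nat_eqI)
  qed
  define p where "p = s * b div q"
  have "s * c \<le> s * b" using bc by simp
  then have "q \<le> s * b" using s1 by linarith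
  then have p1: "1 \<le> p" using q by (simp add: p_def Suc_le_eq div_greater_zero_iff)
  have aq: "2 * a < q" using small by (simp add: a_def)
  have Ns: "s * a div q = p + 1" using N[OF sq] sc1 by (simp add: p_def)
  \<comment> \<open>With slope below one half, \<open>k * a div q\<close> rises by at most 1 per
    step. The rise at step \<open>s\<close> belongs to \<open>c\<close>, so \<open>b\<close> has
    made its \<open>p\<close>-th jump before.\<close>
  have pb: "p * q \<le> (s - 1) * b"
  proof -
    have "(p + 1) * q \<le> s * a" using Ns q by (metis div_times_less_eq_dividend)
    moreover have "s * a = (s - 1) * a + a" using spos by (simp add: algebra_simps diff_mult_distrib)
    ultimately have "p * q \<le> (s - 1) * a" using aq by (simp add: algebra_simps)
    then have "p \<le> (s - 1) * a div q" using q by (simp add: less_eq_div_iff_mult_less_eq)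
    moreover have "(s - 1) * c div q = 0" using sc by simp
    ultimately have "p \<le> (s - 1) * b div q" using N[of "s - 1"] sq by simp
    then show ?thesis using q by (simp add: less_eq_div_iff_mult_less_eq)
  qed
  define s' where "s' = (LEAST k. p * q \<le> k * b)"
  have s'1: "p * q \<le> s' * b" unfolding s'_def by (rule LeastI[of "\<lambda>k. p * q \<le> k * b", OF pb])
  have s'2: "s' \<le> s - 1" unfolding s'_def by (rule Least_le[of "\<lambda>k. p * q \<le> k * b", OF pb])
  have s'pos: "s' > 0" using s'1 p1 q by (cases "s' = 0") auto
  have s'3: "(s' - 1) * b < p * q"
    using not_less_Least[of "s' - 1" "\<lambda>k. p * q \<le> k * b"] s'pos by (auto simp: s'_def)
  have s'4: "(s' - 1) * a < p * q"
  proof -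
    have "(s' - 1) * b div q < p" using s'3 q by (simp add: div_less_iff_less_mult)
    moreover have "(s' - 1) * c div q = 0" using s2[of "s' - 1"] s'2 spos by simp
    ultimately have "(s' - 1) * a div q < p" using N[of "s' - 1"] s'2 sq by simp
    then show ?thesis using q by (simp add: div_less_iff_less_mult)
  qed
  \<comment> \<open>Since \<open>s - 1 <= q - s\<close>, the range after \<open>s\<close> has room
    for at least \<open>p >= 1\<close> further multiples of \<open>q\<close>. As \<open>bmod\<close>
    makes \<open>p * q < s * b\<close> strict, this gives \<open>p + 2 <= b\<close>, so jump
    \<open>p + 1\<close> comes before \<open>q\<close>.\<close>
  have last: "(p + 1) * q \<le> (q - 1) * b"
  proof -
    have "s * b mod q \<noteq> 0" using bmod[of s] spos sq by auto
    moreover have "p * q + s * b mod q = s * b" by (simp add: p_def)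
    ultimately have 1: "p * q < s * b" by linarith
    have "q \<le> p * q" using p1 by simp
    also have "\<dots> \<le> (s - 1) * b" by (rule pb)
    also have "\<dots> \<le> (q - s) * b" using s3 by (intro mult_le_mono) auto
    finally have "q + s * b \<le> q * b" using sq by (simp add: diff_mult_distrib)
    with 1 have "(p + 1) * q < q * b" by simp
    then have "(p + 1) * q < b * q" by (simp only: mult.commute[of q b])
    then have "p + 1 < b" by (rule mult_right_less_imp_less) simp
    then have "(p + 2) * q \<le> b * q" by (intro mult_le_mono) auto
    then show ?thesis using q by (simp add: diff_mult_distrib algebra_simps)
  qed
  define t where "t = (LEAST k. (p + 1) * q \<le> k * b)"
  have t1: "(p + 1) * q \<le> t * b" unfolding t_def by (rule LeastI[of "\<lambda>k. (p + 1) * q \<le> k * b", OF last])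
  have t2: "t \<le> q - 1" unfolding t_def by (rule Least_le[of "\<lambda>k. (p + 1) * q \<le> k * b", OF last])
  have st: "s < t"
  proof (rule ccontr)
    assume "\<not> s < t"
    then have "t * b \<le> s * b" by simp
    then have "(p + 1) * q \<le> s * b" using t1 by linarith
    then have "p + 1 \<le> p" using q unfolding p_def by (simp add: less_eq_div_iff_mult_less_eq)
    then show False by simp
  qed
  have t3: "(t - 1) * b < (p + 1) * q"
    using not_less_Least[of "t - 1" "\<lambda>k. (p + 1) * q \<le> k * b"] st by (auto simp: t_def)
  have t4: "(p + 2) * q \<le> t * a"
  proof -
    have "p + 1 \<le> t * b div q" using t1 q by (simp add: less_eq_div_iff_mult_less_eq)
    moreover have "s * c \<le> t * c" using st by simp
    then have "q \<le> t * c" using s1 by linarith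
    then have "1 \<le> t * c div q" using q by (simp add: Suc_le_eq div_greater_zero_iff)
    moreover have "t < q" using t2 q by linarith
    ultimately have "p + 2 \<le> t * a div q" using N[of t] by linarith
    then show ?thesis using q by (simp add: less_eq_div_iff_mult_less_eq)
  qed
  \<comment> \<open>The combined function jumps at \<open>s'\<close>, \<open>s\<close> and
    \<open>t\<close>, so \<open>(g + 2) * a > 2 * q\<close>. But \<open>g * b < q\<close> means that
    there is no jump up to time \<open>g\<close>, so \<open>g * a < q\<close>, and
    \<open>2 * a < q\<close> gives the contradiction.\<close>
  define g where "g = t - 1 - s'"
  have t_eq: "t - 1 = g + s'" "t = g + s' + 1" using st s'2 by (auto simp: g_def)
  have gb: "g * b < q"
  proof -
    have "g * b + s' * b < p * q + q" using t3 by (simp add: t_eq algebra_simps)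
    then show ?thesis using s'1 by linarith
  qed
  have "g * c \<le> g * b" using bc by simp
  then have "g * c < q" using gb by linarith
  moreover have "g < q" using t2 q unfolding g_def by linarith
  ultimately have "g * a div q = 0" using N[of g] gb by (metis add_0 div_less)
  then have ga: "g * a < q" using q by (simp add: div_eq_0_iff)
  have "s' * a = (s' - 1) * a + a" using s'pos by (simp add: algebra_simps diff_mult_distrib)
  then have "s' * a < p * q + a" using s'4 by linarith
  moreover have "t * a = g * a + s' * a + a" by (simp add: t_eq algebra_simps)
  moreover have "(p + 2) * q = p * q + 2 * q" by (simp add: algebra_simps)
  ultimately show False using t4 ga aq by linarith
qed

lemma div_split:
  fixes q b c :: nat
  assumes split: "\<And>k. k < q \<Longrightarrow> k * b div q + k * c div q = k * (b + c - 1) div q"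
    and small: "2 * (b + c - 1) < q"
    and "\<And>k. 1 \<le> k \<Longrightarrow> k < q \<Longrightarrow> k * b mod q \<noteq> 0"
    and "\<And>k. 1 \<le> k \<Longrightarrow> k < q \<Longrightarrow> k * c mod q \<noteq> 0"
    and "1 \<le> b" "1 \<le> c"
  shows "b = 1 \<or> c = 1"
proof (rule ccontr)
  assume "\<not> ?thesis"
  then have "2 \<le> b" "2 \<le> c" using assms(5,6) by auto
  show False
  proof (cases "c \<le> b")
    case True
    show False by (rule div_split_False[OF split small assms(3) \<open>2 \<le> c\<close> True])
  next
    case False
    have split': "k * c div q + k * b div q = k * (c + b - 1) div q" if "k < q" for k
      using split[OF that] by (simp only: add.commute)
    have small': "2 * (c + b - 1) < q" using small by (simp only: add.commute)
    have "b \<le> c" using False by simp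
    show False by (rule div_split_False[OF split' small' assms(4) \<open>2 \<le> b\<close> \<open>b \<le> c\<close>])
  qed
qed

text \<open>The complement of the large weight is \<open>q - a = b + c - 1\<close>, and the quotient
  of \<open>k * (q - a)\<close> is \<open>k - 1 - k * a div q\<close>. So \<open>dv\<close> turns
  into the splitting required by \<open>div_split\<close>, with slope below one half.\<close>

lemma terminal_aux:
  fixes q a b c :: nat
  assumes sum: "a + b + c = q + 1" and pos: "1 \<le> b" "1 \<le> c" and a: "q \<le> 2 * a" "a < q"
    and q: "3 \<le> q"
    and md: "\<And>k. 1 \<le> k \<Longrightarrow> k < q \<Longrightarrow> k * a mod q \<noteq> 0"
       "\<And>k. 1 \<le> k \<Longrightarrow> k < q \<Longrightarrow> k * b mod q \<noteq> 0" "\<And>k. 1 \<le> k \<Longrightarrow> k < q \<Longrightarrow> k * c mod q \<noteq> 0"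
    and dv: "\<And>k. 1 \<le> k \<Longrightarrow> k < q \<Longrightarrow> k * a div q + k * b div q + k * c div q = k - 1"
  shows "b = 1 \<or> c = 1"
proof (rule div_split[of q])
  fix k assume k: "k < q"
  show "k * b div q + k * c div q = k * (b + c - 1) div q"
  proof (cases "k = 0")
    case False
    define A where "A = k * a div q"
    define r where "r = k * a mod q"
    have r: "0 < r" "r < q" using md(1)[of k] k False by (auto simp: r_def)
    have e: "k * a = A * q + r" by (simp add: A_def r_def)
    have 1: "A + (k * b div q + k * c div q) = k - 1" using dv[of k] k False by (simp add: A_def)
    then have k1: "k = A + (k * b div q + k * c div q) + 1" using False by simp
    define B where "B = k * b div q + k * c div q"
    have "b + c - 1 = q - a" using sum pos by simp
    then have "k * (b + c - 1) = k * q - k * a" by (simp add: diff_mult_distrib2)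
    also have "\<dots> = (A + B + 1) * q - (A * q + r)" using e k1 by (metis B_def)
    also have "\<dots> = B * q + (q - r)" using r by (simp add: algebra_simps)
    finally have e': "k * (b + c - 1) = B * q + (q - r)" .
    have "k * (b + c - 1) div q = B" unfolding e' using r by (intro div_mod_step) auto
    then show ?thesis by (simp add: B_def)
  qed auto
next
  have "2 * a \<noteq> q" using md(1)[of 2] q by auto
  then show "2 * (b + c - 1) < q" using sum pos a by simp
qed (use assms in auto)

text \<open>White's terminal lemma on empty lattice tetrahedra. With d = 2 q - 1 - a - b the residues of k
  times 1, a, b, d sum to 2 q for all k, and in terms of q - a, q - b, q - d this is a relation
  between quotients.\<close>
lemma terminal_lemma:
  fixes q a b :: nat
  assumes q: "2 \<le> q" and ab: "a < q" "b < q"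
    and md: "\<And>k. 1 \<le> k \<Longrightarrow> k < q \<Longrightarrow> k * a mod q \<noteq> 0"
       "\<And>k. 1 \<le> k \<Longrightarrow> k < q \<Longrightarrow> k * b mod q \<noteq> 0"
    and lo: "\<And>k. 1 \<le> k \<Longrightarrow> k < q \<Longrightarrow> q < k * a mod q + k * b mod q + k"
    and hi: "\<And>k. 1 \<le> k \<Longrightarrow> k < q \<Longrightarrow> k * a mod q + k * b mod q + k < 2 * q"
  shows "a + b = q \<or> a + 1 = q \<or> b + 1 = q"
proof (cases "q = 2")
  case True
  then have "a = 1" using md(1)[of 1] ab by (cases "a = 0") auto
  then show ?thesis using True by simp
next
  case False
  \<comment> \<open>This \<open>d\<close> is \<open>q\<close> minus the fourth weight
    \<open>2 * q - 1 - a - b\<close>, just as \<open>a'\<close> and \<open>b'\<close> are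
    complements; the three add up to \<open>q + 1\<close>, as \<open>terminal_aux\<close>
    expects.\<close>
  define a' b' d where "a' = q - a" "b' = q - b" "d = a + b + 1 - q"
  have *: "q < a + b + 1" "a + b + 1 < 2 * q" using lo[of 1] hi[of 1] q ab by auto
  have sum: "a' + b' + d = q + 1" using * ab by (auto simp: a'_b'_d_def)
  have a0: "a > 0" "b > 0" using md(1)[of 1] md(2)[of 1] q ab by (auto intro: gr0I)
  have lt: "a' < q" "b' < q" "d < q" "1 \<le> a'" "1 \<le> b'" "1 \<le> d"
    using * a0 ab by (auto simp: a'_b'_d_def)
  have neg: "k * (q - x) mod q = q - k * x mod q \<and> k * (q - x) div q + k * x div q + 1 = k"
    if k: "1 \<le> k" "k < q" and x: "x < q" "k * x mod q \<noteq> 0" for k x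
  proof -
    define A r where "A = k * x div q" "r = k * x mod q"
    have e: "k * x = A * q + r" by (simp add: A_r_def)
    have r: "0 < r" "r < q" using x q by (auto simp: A_r_def)
    have "k * x < k * q" using x k by simp
    then have "A * q < k * q" using e by linarith
    then have Ak: "A < k" by simp
    then obtain B where B: "k = A + B + 1" using less_imp_Suc_add by (metis Suc_eq_plus1 add_Suc_right)
    have "k * (q - x) = k * q - (A * q + r)" by (simp add: diff_mult_distrib2 e)
    also have "\<dots> = B * q + (q - r)" using r by (simp add: B algebra_simps)
    finally have f: "k * (q - x) = B * q + (q - r)" .
    have "q - r < q" using r by simp
    then have B': "k * (q - x) div q = B" "k * (q - x) mod q = q - r" unfolding f by (rule div_mod_step)+
    show ?thesis unfolding A_r_def[symmetric] B' using B by simp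
  qed
  have key: "k * d mod q \<noteq> 0 \<and> k * a' div q + k * b' div q + k * d div q = k - 1"
    if k: "1 \<le> k" "k < q" for k
  proof -
    define A r B s where "A = k * a div q" "r = k * a mod q" "B = k * b div q" "s = k * b mod q"
    note defs = this
    have e: "k * a = A * q + r" "k * b = B * q + s" by (simp_all add: defs)
    have r: "0 < r" "r < q" "0 < s" "s < q" using md[of k] k q by (auto simp: defs)
    have rs: "q < r + s + k" "r + s + k < 2 * q" using lo[OF k] hi[OF k] by (simp_all add: defs)
    have na: "k * a' div q + A + 1 = k" "k * b' div q + B + 1 = k"
      using neg[OF k ab(1) md(1)[OF k]] neg[OF k ab(2) md(2)[OF k]] by (simp_all only: defs a'_b'_d_def)
    have "k * d + k * q = (A + B) * q + (r + s + k)"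
    proof -
      have "k * d + k * q = k * (d + q)" by (simp add: algebra_simps)
      also have "d + q = a + b + 1" using * by (simp add: a'_b'_d_def)
      finally show ?thesis using e by (simp add: algebra_simps)
    qed
    then have kd: "k * d + k * q = (A + B + 1) * q + (r + s + k - q)" using rs by (simp add: algebra_simps)
    define w where "w = r + s + k - q"
    have w: "0 < w" "w < q" using rs by (auto simp: w_def)
    have "k * q < (A + B + 2) * q"
    proof -
      have "k * q \<le> k * d + k * q" by simp
      also have "\<dots> < (A + B + 1) * q + q" using kd w by (simp add: w_def)
      finally show ?thesis by (simp add: algebra_simps)
    qed
    then have "k < A + B + 2" by (rule mult_right_less_imp_less) simp
    then obtain D where D: "A + B + 1 = k + D" using le_Suc_ex[of k "A + B + 1"] by auto
    have "k * d = D * q + w" using kd unfolding D w_def[symmetric] by (simp add: algebra_simps)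
    then have "k * d mod q = w" "k * d div q = D" using w by simp_all
    then show ?thesis using na D w by simp
  qed
  have md': "k * a' mod q \<noteq> 0" "k * b' mod q \<noteq> 0" if "1 \<le> k" "k < q" for k
    using neg[of k a] neg[of k b] that ab md[of k] q by (auto simp: a'_b'_d_def not_le)
  have q3: "3 \<le> q" using False q by simp
  \<comment> \<open>At \<open>k = 2\<close> one of the three quotients is positive, so one of the
    complements is at least \<open>q / 2\<close>. This instance is the reason for treating
    \<open>q = 2\<close> apart.\<close>
  have "2 * a' div q + 2 * b' div q + 2 * d div q = 1" using key[of 2] q3 by auto
  then have "2 * a' div q > 0 \<or> 2 * b' div q > 0 \<or> 2 * d div q > 0" by linarith
  then have "q \<le> 2 * a' \<or> q \<le> 2 * b' \<or> q \<le> 2 * d" by (auto simp: div_greater_zero_iff)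
  then have "a' = 1 \<or> b' = 1 \<or> d = 1"
  proof (elim disjE)
    assume "q \<le> 2 * a'"
    then have "b' = 1 \<or> d = 1"
      by (rule terminal_aux[OF sum lt(5,6) _ lt(1) q3]) (use md' key in auto)
    then show ?thesis by blast
  next
    assume "q \<le> 2 * b'"
    moreover have "b' + a' + d = q + 1" using sum by simp
    ultimately have "a' = 1 \<or> d = 1"
      by (intro terminal_aux[of b' a' d q] lt q3) (use md' key in \<open>auto simp: add.commute\<close>)
    then show ?thesis by blast
  next
    assume "q \<le> 2 * d"
    moreover have "d + a' + b' = q + 1" using sum by simp
    ultimately have "a' = 1 \<or> b' = 1"
      by (intro terminal_aux[of d a' b' q] lt q3) (use md' key in \<open>auto simp: ac_simps\<close>)
    then show ?thesis by blast
  qed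
  then show ?thesis using * ab by (auto simp: a'_b'_d_def)
qed

subsection \<open>Linear programming duality\<close>

text \<open>Ties explicit non-negative combinations to the library's hull, whose closedness for
  finitely many generators comes from the theory of polyhedra.\<close>

lemma convex_cone_hull_image:
  fixes f :: "nat \<Rightarrow> 'b::euclidean_space"
  assumes J: "finite J"
  shows "convex_cone hull (f ` J) = {\<Sum>j\<in>J. x j *\<^sub>R f j |x. \<forall>j\<in>J. 0 \<le> x j}" (is "?L = ?R")
proof
  show "?L \<subseteq> ?R"
  proof (rule hull_minimal)
    show "f ` J \<subseteq> ?R"
    proof
      fix v assume "v \<in> f ` J"
      then obtain i where i: "i \<in> J" "v = f i" by auto
      have "(\<Sum>j\<in>J. (if j = i then 1 else 0) *\<^sub>R f j) = (\<Sum>j\<in>J. if i = j then f j else 0)"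
        by (intro sum.cong) auto
      then have "v = (\<Sum>j\<in>J. (if j = i then 1 else 0) *\<^sub>R f j)" using i J by simp
      then show "v \<in> ?R" by (auto intro!: exI[of _ "\<lambda>j. if j = i then 1 else 0"])
    qed
    show "convex_cone ?R"
      unfolding convex_cone_def
    proof (intro conjI)
      have "(\<Sum>j\<in>J. 0 *\<^sub>R f j) \<in> ?R" by (intro CollectI exI[of _ "\<lambda>j. 0"]) auto
      then show "?R \<noteq> {}" by blast
      show "conic ?R"
        unfolding conic_def
      proof (intro allI impI)
        fix v :: 'b and c :: real assume "v \<in> ?R" "0 \<le> c"
        then obtain x where "v = (\<Sum>j\<in>J. x j *\<^sub>R f j)" "\<forall>j\<in>J. 0 \<le> x j" by auto
        then show "c *\<^sub>R v \<in> ?R" using \<open>0 \<le> c\<close>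
          by (intro CollectI exI[of _ "\<lambda>j. c * x j"]) (auto simp: scaleR_sum_right)
      qed
      show "convex ?R"
      proof (rule convexI)
        fix v w and s t :: real assume v: "v \<in> ?R" "w \<in> ?R" "0 \<le> s" "0 \<le> t"
        then obtain x y where "v = (\<Sum>j\<in>J. x j *\<^sub>R f j)" "\<forall>j\<in>J. 0 \<le> x j"
          "w = (\<Sum>j\<in>J. y j *\<^sub>R f j)" "\<forall>j\<in>J. 0 \<le> y j" by auto
        then show "s *\<^sub>R v + t *\<^sub>R w \<in> ?R" using v(3,4)
          by (intro CollectI exI[of _ "\<lambda>j. s * x j + t * y j"])
            (auto simp: scaleR_sum_right sum.distrib scaleR_add_left)
      qed
    qed
  qed
  show "?R \<subseteq> ?L"
  proof clarify
    fix x :: "nat \<Rightarrow> real" assume x: "\<forall>j\<in>J. 0 \<le> x j"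
    have "(\<Sum>j\<in>K. x j *\<^sub>R f j) \<in> ?L" if "K \<subseteq> J" for K
      using finite_subset[OF that J] that
    proof (induction K)
      case empty
      then show ?case by (simp add: convex_cone_hull_contains_0)
    next
      case (insert k K)
      have "x k *\<^sub>R f k \<in> ?L" using insert.prems x by (intro convex_cone_hull_mul hull_inc) auto
      then have "x k *\<^sub>R f k + (\<Sum>j\<in>K. x j *\<^sub>R f j) \<in> ?L"
        using insert by (intro convex_cone_hull_add) auto
      then show ?case using insert.hyps by simp
    qed
    then show "(\<Sum>j\<in>J. x j *\<^sub>R f j) \<in> ?L" by blast
  qed
qed

lemma closed_cone_family:
  fixes f :: "nat \<Rightarrow> 'b::euclidean_space"
  assumes "finite J"
  shows "closed {\<Sum>j\<in>J. x j *\<^sub>R f j |x. \<forall>j\<in>J. 0 \<le> x j}"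
  using polyhedron_imp_closed[OF polyhedron_convex_cone_hull[of "f ` J"]] assms
  by (simp add: convex_cone_hull_image)

lemma farkas:
  fixes f :: "nat \<Rightarrow> 'b::euclidean_space"
  assumes J: "finite J"
  obtains x where "\<And>j. j \<in> J \<Longrightarrow> 0 \<le> x j" "w = (\<Sum>j\<in>J. x j *\<^sub>R f j)"
  | y where "\<And>j. j \<in> J \<Longrightarrow> 0 \<le> y \<bullet> f j" "y \<bullet> w < 0"
proof (cases "w \<in> convex_cone hull (f ` J)")
  case True
  then show thesis using that(1) unfolding convex_cone_hull_image[OF J] by auto
next
  case False
  let ?K = "convex_cone hull (f ` J)"
  have "closed ?K" using J by (intro polyhedron_imp_closed polyhedron_convex_cone_hull) auto
  then obtain y b where y: "y \<bullet> w < b" "\<And>v. v \<in> ?K \<Longrightarrow> b < y \<bullet> v"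
    using separating_hyperplane_closed_point[OF convex_convex_cone_hull _ False] by blast
  have "b < 0" using y(2)[OF convex_cone_hull_contains_0] by simp
  moreover have "0 \<le> y \<bullet> f j" if j: "j \<in> J" for j
  proof (rule ccontr)
    assume neg: "\<not> 0 \<le> y \<bullet> f j"
    \<comment> \<open>If \<open>y . f j < 0\<close>, this multiple of \<open>f j\<close> lies in the
      cone and \<open>y\<close> takes the value \<open>b\<close> on it, against the strict
      separation.\<close>
    have "(b / (y \<bullet> f j)) *\<^sub>R f j \<in> ?K"
      using j neg \<open>b < 0\<close> by (intro convex_cone_hull_mul hull_inc) (auto simp: divide_nonpos_neg)
    from y(2)[OF this] show False using neg by simp
  qed
  ultimately show thesis using y(1) by (intro that(2)) auto
qed

text \<open>The setting freed of matrices: \<open>L\<close> plays the role of the integer lattice,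
  and normality says that a non-negative real combination lying in \<open>L\<close> is also one with
  natural coefficients. \<open>norm_Rats\<close> keeps the later costs rational.\<close>

locale column_config =
  fixes a :: "nat \<Rightarrow> 'v::euclidean_space" and n :: nat and L :: "'v set"
  assumes dim3: "DIM('v) \<le> 3"
    and L_zero: "0 \<in> L"
    and L_diff: "\<And>v w. v \<in> L \<Longrightarrow> w \<in> L \<Longrightarrow> v - w \<in> L"
    and a_L: "\<And>j. j < n \<Longrightarrow> a j \<in> L"
    and normal: "\<And>x. (\<forall>j<n. 0 \<le> x j) \<Longrightarrow> (\<Sum>j<n. x j *\<^sub>R a j) \<in> L \<Longrightarrow>
          \<exists>u :: nat \<Rightarrow> nat. (\<Sum>j<n. x j *\<^sub>R a j) = (\<Sum>j<n. real (u j) *\<^sub>R a j)"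
    and kernel: "\<And>x. (\<forall>j<n. 0 \<le> x j) \<Longrightarrow> (\<Sum>j<n. x j *\<^sub>R a j) = 0 \<Longrightarrow> \<forall>j<n. x j = 0"
    and norm_Rats: "\<And>j. j < n \<Longrightarrow> a j \<bullet> a j \<in> \<rat>"
begin

definition comb :: "(nat \<Rightarrow> real) \<Rightarrow> 'v" where
  "comb x = (\<Sum>j<n. x j *\<^sub>R a j)"

text \<open>The dual polyhedron of the linear relaxation; the faces of \<open>Delta\<close> will be
  exactly the sets \<open>tight c y\<close> with \<open>feas c y\<close>.\<close>

definition feas :: "(nat \<Rightarrow> real) \<Rightarrow> 'v \<Rightarrow> bool" where
  "feas c y \<longleftrightarrow> (\<forall>j<n. y \<bullet> a j \<le> c j)"

definition tight :: "(nat \<Rightarrow> real) \<Rightarrow> 'v \<Rightarrow> nat set" where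
  "tight c y = {j. j < n \<and> y \<bullet> a j = c j}"

text \<open>The vectors vanish off the set on all of \<open>nat\<close>, also beyond
  \<open>n\<close>, so that coordinates are unique as functions.\<close>

definition supp_in :: "(nat \<Rightarrow> real) \<Rightarrow> nat set \<Rightarrow> bool" where
  "supp_in x \<sigma> \<longleftrightarrow> (\<forall>j. j \<notin> \<sigma> \<longrightarrow> x j = 0)"

definition indep :: "nat set \<Rightarrow> bool" where
  "indep \<sigma> \<longleftrightarrow> \<sigma> \<subseteq> {..<n} \<and> (\<forall>x. supp_in x \<sigma> \<longrightarrow> comb x = 0 \<longrightarrow> (\<forall>j. x j = 0))"

text \<open>Says that the subdivision induced by \<open>c\<close> is simplicial.\<close>

definition generic :: "(nat \<Rightarrow> real) \<Rightarrow> bool" where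
  "generic c \<longleftrightarrow> (\<forall>y. feas c y \<longrightarrow> indep (tight c y))"

text \<open>Coefficient vectors of the non-zero lattice points in the half-open parallelepiped of the
  columns in \<open>\<sigma>\<close>; the cone on an independent \<open>\<sigma>\<close> is unimodular iff there are none.\<close>
definition frac_pts :: "nat set \<Rightarrow> (nat \<Rightarrow> real) set" where
  "frac_pts \<sigma> = {x. supp_in x \<sigma> \<and> (\<forall>j. 0 \<le> x j \<and> x j < 1) \<and> (\<exists>j. x j \<noteq> 0) \<and> comb x \<in> L}"

lemma comb_add: "comb (\<lambda>j. x j + y j) = comb x + comb y"
  by (simp add: comb_def scaleR_add_left sum.distrib)

lemma comb_diff: "comb (\<lambda>j. x j - y j) = comb x - comb y"
  by (simp add: comb_def scaleR_diff_left sum_subtractf)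

lemma comb_scale: "comb (\<lambda>j. r * x j) = r *\<^sub>R comb x"
  by (simp add: comb_def scaleR_sum_right)

lemma inner_comb: "y \<bullet> comb x = (\<Sum>j<n. x j * (y \<bullet> a j))"
  by (simp add: comb_def inner_sum_right)

lemma comb_cong: "(\<And>j. j < n \<Longrightarrow> x j = y j) \<Longrightarrow> comb x = comb y"
  by (simp add: comb_def)

lemma comb_single: "k < n \<Longrightarrow> comb (\<lambda>j. if j = k then r else 0) = r *\<^sub>R a k"
proof -
  assume k: "k < n"
  have "comb (\<lambda>j. if j = k then r else 0) = (\<Sum>j<n. if k = j then r *\<^sub>R a j else 0)"
    unfolding comb_def by (intro sum.cong) auto
  then show ?thesis using k by simp
qed

lemma indep_unique:
  assumes "indep \<sigma>" "supp_in x \<sigma>" "supp_in y \<sigma>" "comb x = comb y"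
  shows "x = y"
proof -
  have "supp_in (\<lambda>j. x j - y j) \<sigma>" using assms(2,3) by (auto simp: supp_in_def)
  moreover have "comb (\<lambda>j. x j - y j) = 0" using assms(4) by (simp add: comb_diff)
  ultimately have "\<forall>j. x j - y j = 0" using assms(1) unfolding indep_def by blast
  then show ?thesis by auto
qed

lemma L_minus: "v \<in> L \<Longrightarrow> - v \<in> L"
  using L_diff[OF L_zero, of v] by simp

lemma L_add: "v \<in> L \<Longrightarrow> w \<in> L \<Longrightarrow> v + w \<in> L"
  using L_diff[of v "- w"] L_minus[of w] by simp

lemma L_of_nat: "v \<in> L \<Longrightarrow> real k *\<^sub>R v \<in> L"
  by (induction k) (auto simp: L_zero scaleR_add_left intro: L_add)

lemma L_of_int: "v \<in> L \<Longrightarrow> real_of_int k *\<^sub>R v \<in> L"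
  by (cases k rule: int_cases2) (auto intro: L_of_nat dest: L_minus[OF L_of_nat])

lemma L_Ints: "v \<in> L \<Longrightarrow> r \<in> \<int> \<Longrightarrow> r *\<^sub>R v \<in> L"
  by (elim Ints_cases) (auto intro: L_of_int)

lemma L_comb: "(\<And>j. j < n \<Longrightarrow> x j \<in> \<int>) \<Longrightarrow> comb x \<in> L"
proof -
  assume x: "\<And>j. j < n \<Longrightarrow> x j \<in> \<int>"
  have "(\<Sum>j<m. x j *\<^sub>R a j) \<in> L" if "m \<le> n" for m
    using that by (induction m) (auto simp: L_zero intro!: L_add L_Ints a_L x)
  then show ?thesis by (simp add: comb_def)
qed

text \<open>Farkas for the columns lifted to \<open>(a j, - 1)\<close>: a combination hitting
  \<open>(0, - 1)\<close> has total weight 1 and contradicts \<open>kernel\<close>, while a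
  separating functional is at least a positive constant on all columns.\<close>

lemma pos_functional: obtains y where "\<And>j. j < n \<Longrightarrow> 0 < y \<bullet> a j"
proof (rule farkas[of "{..<n}" "(0, -1)" "\<lambda>j. (a j, - 1 :: real)"])
  fix x assume x: "\<And>j. j \<in> {..<n} \<Longrightarrow> 0 \<le> x j" "(0, -1) = (\<Sum>j<n. x j *\<^sub>R (a j, - 1 :: real))"
  have "(\<Sum>j<n. x j *\<^sub>R (a j, - 1 :: real)) = (\<Sum>j<n. x j *\<^sub>R a j, - (\<Sum>j<n. x j))"
    by (simp add: prod_eq_iff fst_sum snd_sum sum_negf)
  then have e: "(\<Sum>j<n. x j *\<^sub>R a j) = 0" "(\<Sum>j<n. x j) = 1"
    using x(2) by (simp_all add: prod_eq_iff)
  have "\<forall>j<n. 0 \<le> x j" using x(1) by simp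
  then have "\<forall>j<n. x j = 0" using e(1) by (rule kernel)
  then have "(\<Sum>j<n. x j) = 0" by simp
  then show thesis using e(2) by simp
next
  fix z :: "'v \<times> real" assume z: "\<And>j. j \<in> {..<n} \<Longrightarrow> 0 \<le> z \<bullet> (a j, - 1)" "z \<bullet> (0, -1) < 0"
  have "0 < fst z \<bullet> a j" if "j < n" for j
    using z(1)[of j] z(2) that by (cases z) (auto simp: inner_Pair intro: less_le_trans)
  then show thesis by (rule that)
qed auto

lemma feas_exists: "\<exists>y. feas c y"
proof -
  obtain y where y: "\<And>j. j < n \<Longrightarrow> 0 < y \<bullet> a j" using pos_functional by blast
  define M where "M = (\<Sum>j<n. \<bar>c j\<bar> / (y \<bullet> a j))"
  have "feas c (- M *\<^sub>R y)"
    unfolding feas_def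
  proof (intro allI impI)
    fix j assume j: "j < n"
    have "\<bar>c j\<bar> / (y \<bullet> a j) \<le> M"
      unfolding M_def using j y by (intro member_le_sum) (auto intro!: divide_nonneg_pos)
    then have "\<bar>c j\<bar> \<le> M * (y \<bullet> a j)" using y[OF j] by (simp add: pos_divide_le_eq)
    then show "- M *\<^sub>R y \<bullet> a j \<le> c j" by simp
  qed
  then show ?thesis by blast
qed

text \<open>Strong duality with complementary slackness. The attainable costs form a slice of a
  closed cone and are bounded below by weak duality, so a cheapest \<open>x\<close> exists; Farkas
  yields a \<open>y\<close> of the same value, and then the support of \<open>x\<close> must be
  tight.\<close>

lemma lp_dual:
  assumes x0: "\<And>j. j < n \<Longrightarrow> 0 \<le> x0 j"
  obtains y x where "feas c y" "supp_in x (tight c y)" "\<And>j. 0 \<le> x j" "comb x = comb x0"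
proof -
  define v where "v = comb x0"
  define K where "K = {\<Sum>j<n. x j *\<^sub>R (a j, c j) |x. \<forall>j\<in>{..<n}. 0 \<le> x j}"
  define R where "R = {r. (v, r) \<in> K}"
  have R: "R = {\<Sum>j<n. x j * c j |x. (\<forall>j<n. 0 \<le> x j) \<and> comb x = v}"
  proof -
    have "(v, r) = (\<Sum>j<n. x j *\<^sub>R (a j, c j)) \<longleftrightarrow> comb x = v \<and> r = (\<Sum>j<n. x j * c j)" for r x
      by (auto simp: comb_def prod_eq_iff fst_sum snd_sum)
    then show ?thesis unfolding R_def K_def by auto
  qed
  have "closed R"
  proof -
    have "closed K" unfolding K_def by (rule closed_cone_family) auto
    then have "closed ((\<lambda>r. (v, r)) -` K)" by (intro closed_vimage) (auto intro!: continuous_intros)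
    then show ?thesis by (simp add: R_def vimage_def)
  qed
  moreover have "R \<noteq> {}" unfolding R v_def using x0 by blast
  moreover have "bdd_below R"
  proof -
    obtain y1 where y1: "feas c y1" using feas_exists by blast
    have "y1 \<bullet> v \<le> r" if r: "r \<in> R" for r
    proof -
      obtain x where x: "\<forall>j<n. 0 \<le> x j" "comb x = v" "r = (\<Sum>j<n. x j * c j)" using r unfolding R by auto
      have "y1 \<bullet> v = (\<Sum>j<n. x j * (y1 \<bullet> a j))" unfolding x(2)[symmetric] by (rule inner_comb)
      also have "\<dots> \<le> r" unfolding x(3) using x(1) y1
        by (intro sum_mono mult_left_mono) (simp_all add: feas_def)
      finally show ?thesis .
    qed
    then show ?thesis by (auto simp: bdd_below_def)
  qed
  ultimately have "Inf R \<in> R" by (intro closed_contains_Inf)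
  then obtain x where x: "\<And>j. j < n \<Longrightarrow> 0 \<le> x j" "comb x = v" and xr: "Inf R = (\<Sum>j<n. x j * c j)"
    unfolding R by auto
  define r where "r = Inf R"
  have rmin: "r \<le> (\<Sum>j<n. x' j * c j)" if "\<forall>j<n. 0 \<le> x' j" "comb x' = v" for x'
  proof -
    have "(\<Sum>j<n. x' j * c j) \<in> R" unfolding R using that by blast
    then show ?thesis unfolding r_def by (intro cInf_lower \<open>bdd_below R\<close>)
  qed
  \<comment> \<open>The additional generator \<open>(- v, - r)\<close> encodes the optimal value: a
    combination equal to \<open>(0, - 1)\<close> would, divided by its weight \<open>w n\<close>,
    represent \<open>v\<close> at a cost below \<open>r\<close>, or contradict \<open>kernel\<close>
    if \<open>w n = 0\<close>.\<close>
  define f where "f = (\<lambda>j. if j = n then (- v, - r) else (a j, c j))"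
  have "\<exists>y. feas c y \<and> r \<le> y \<bullet> v"
  proof (rule farkas[of "{..n}" "(0, -1)" f])
    fix w assume w: "\<And>j. j \<in> {..n} \<Longrightarrow> 0 \<le> w j" "(0, -1) = (\<Sum>j\<le>n. w j *\<^sub>R f j)"
    have "(\<Sum>j\<le>n. w j *\<^sub>R f j) = (\<Sum>j<n. w j *\<^sub>R (a j, c j)) + w n *\<^sub>R (- v, - r)"
      unfolding lessThan_Suc_atMost[symmetric] by (simp add: f_def)
    also have "(\<Sum>j<n. w j *\<^sub>R (a j, c j)) = (comb w, \<Sum>j<n. w j * c j)"
      by (simp add: comb_def prod_eq_iff fst_sum snd_sum)
    finally have e: "0 = comb w - w n *\<^sub>R v" "-1 = (\<Sum>j<n. w j * c j) - w n * r"
      unfolding w(2)[symmetric] by simp_all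
    show ?thesis
    proof (cases "w n = 0")
      case True
      have "\<forall>j<n. 0 \<le> w j" using w(1) by simp
      moreover have "(\<Sum>j<n. w j *\<^sub>R a j) = 0" using e(1) unfolding True comb_def by simp
      ultimately have "\<forall>j<n. w j = 0" by (rule kernel)
      then have "(\<Sum>j<n. w j * c j) = 0" by simp
      then show ?thesis using e(2) unfolding True by simp
    next
      case False
      then have wn: "0 < w n" using w(1)[of n] by auto
      define x' where "x' = (\<lambda>j. (1 / w n) * w j)"
      have "comb w = w n *\<^sub>R v" using e(1) by (metis eq_iff_diff_eq_0)
      then have "comb x' = v" using False unfolding x'_def comb_scale by simp
      moreover have "\<forall>j<n. 0 \<le> x' j" using w(1) wn by (auto simp: x'_def)
      ultimately have "r \<le> (\<Sum>j<n. x' j * c j)" by (intro rmin)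
      also have "\<dots> = (1 / w n) * (\<Sum>j<n. w j * c j)" by (simp add: x'_def sum_distrib_left mult_ac)
      finally have "r * w n \<le> (\<Sum>j<n. w j * c j)" using wn by (simp add: field_simps)
      then show ?thesis using e(2) mult.commute[of r "w n"] by linarith
    qed
  next
    fix z assume z: "\<And>j. j \<in> {..n} \<Longrightarrow> 0 \<le> z \<bullet> f j" "z \<bullet> (0, -1) < 0"
    obtain y s where ys: "z = (y, s)" by (cases z)
    have s: "s > 0" using z(2) by (simp add: ys)
    have zj: "0 \<le> y \<bullet> a j + s * c j" if "j < n" for j
      using z(1)[of j] that by (simp add: ys f_def inner_prod_def)
    have "y \<bullet> v + s * r \<le> 0" using z(1)[of n] by (simp add: ys f_def inner_prod_def)
    then have "r \<le> ((- 1 / s) *\<^sub>R y) \<bullet> v" using s by (simp add: field_simps)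
    moreover have "((- 1 / s) *\<^sub>R y) \<bullet> a j \<le> c j" if "j < n" for j
      using zj[OF that] s by (simp add: field_simps)
    then have "feas c ((- 1 / s) *\<^sub>R y)" by (simp add: feas_def)
    ultimately show ?thesis by blast
  qed auto
  then obtain y where y: "feas c y" "r \<le> y \<bullet> v" by blast
  have "(\<Sum>j<n. x j * (c j - y \<bullet> a j)) \<le> 0"
    using y(2) xr x(2)[symmetric] by (simp add: r_def inner_comb right_diff_distrib sum_subtractf)
  moreover have nn: "0 \<le> x j * (c j - y \<bullet> a j)" if "j < n" for j
    using x(1)[OF that] y(1) that by (auto simp: feas_def)
  ultimately have z: "(\<Sum>j<n. x j * (c j - y \<bullet> a j)) = 0" by (intro antisym sum_nonneg) auto
  have "(\<Sum>j<n. x j * (c j - y \<bullet> a j)) = 0 \<longleftrightarrow> (\<forall>j\<in>{..<n}. x j * (c j - y \<bullet> a j) = 0)"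
    using nn by (intro sum_nonneg_eq_0_iff) auto
  with z have "\<forall>j\<in>{..<n}. x j * (c j - y \<bullet> a j) = 0" by blast
  then have *: "x j = 0 \<or> y \<bullet> a j = c j" if "j < n" for j
    using that by (metis eq_iff_diff_eq_0 lessThan_iff mult_eq_0_iff)
  define x' where "x' = (\<lambda>j. if j < n then x j else 0)"
  have "comb x' = comb x0" using x(2) by (auto simp: x'_def comb_def v_def)
  moreover have "supp_in x' (tight c y)" using * by (auto simp: supp_in_def tight_def x'_def)
  moreover have "0 \<le> x' j" for j using x(1) by (auto simp: x'_def)
  ultimately show thesis using y(1) that by blast
qed

end

subsection \<open>The lower hull\<close>

lemma eventually_poly_nonzero:
  fixes p :: "real poly"
  assumes "p \<noteq> 0"
  shows "\<forall>\<^sub>F t in at_right 0. poly p t \<noteq> 0"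
proof -
  have "finite ({t. poly p t = 0} - {0})" using poly_roots_finite[OF assms] by simp
  then have "open (- ({t. poly p t = 0} - {0}))" by (intro open_Compl finite_imp_closed)
  then show ?thesis unfolding eventually_at_topological
    by (intro exI[of _ "- ({t. poly p t = 0} - {0})"]) auto
qed

context column_config
begin

definition sz :: "(nat \<Rightarrow> real) \<Rightarrow> real" where
  "sz x = (\<Sum>j<n. x j)"

lemma supp_in_mono: "supp_in x \<sigma> \<Longrightarrow> \<sigma> \<subseteq> \<tau> \<Longrightarrow> supp_in x \<tau>"
  by (auto simp: supp_in_def)

lemma comb_supp:
  assumes "supp_in x \<sigma>" "\<sigma> \<subseteq> {..<n}"
  shows "comb x = (\<Sum>j\<in>\<sigma>. x j *\<^sub>R a j)"
  unfolding comb_def using assms by (intro sum.mono_neutral_right) (auto simp: supp_in_def)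

lemma sz_supp:
  assumes "supp_in x \<sigma>" "\<sigma> \<subseteq> {..<n}"
  shows "sz x = (\<Sum>j\<in>\<sigma>. x j)"
  unfolding sz_def using assms by (intro sum.mono_neutral_right) (auto simp: supp_in_def)

lemma indep_subset: "indep \<sigma> \<Longrightarrow> \<sigma> \<subseteq> {..<n}"
  by (simp add: indep_def)

lemma indep_finite: "indep \<sigma> \<Longrightarrow> finite \<sigma>"
  using indep_subset finite_subset by blast

lemma indep_inj: "indep \<sigma> \<Longrightarrow> inj_on a \<sigma>"
proof (rule inj_onI)
  fix i j assume \<sigma>: "indep \<sigma>" and ij: "i \<in> \<sigma>" "j \<in> \<sigma>" "a i = a j"
  let ?e = "\<lambda>i k. if k = i then 1 else 0 :: real"
  have "i < n" "j < n" using ij indep_subset[OF \<sigma>] by auto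
  then have "comb (?e i) = comb (?e j)" using ij by (simp add: comb_single)
  then have "?e i = ?e j"
    using ij by (intro indep_unique[OF \<sigma>]) (auto simp: supp_in_def)
  then show "i = j" by (metis zero_neq_one)
qed

lemma indep_independent: "indep \<sigma> \<Longrightarrow> independent (a ` \<sigma>)"
proof
  assume \<sigma>: "indep \<sigma>" and "dependent (a ` \<sigma>)"
  then obtain u v where u: "v \<in> a ` \<sigma>" "u v \<noteq> 0" "(\<Sum>v\<in>a ` \<sigma>. u v *\<^sub>R v) = 0"
    using dependent_finite[of "a ` \<sigma>"] indep_finite by auto
  define x where "x = (\<lambda>j. if j \<in> \<sigma> then u (a j) else 0)"
  have sx: "supp_in x \<sigma>" by (auto simp: x_def supp_in_def)
  have "comb x = (\<Sum>j\<in>\<sigma>. u (a j) *\<^sub>R a j)"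
    unfolding comb_supp[OF sx indep_subset[OF \<sigma>]] by (intro sum.cong) (auto simp: x_def)
  also have "\<dots> = 0" using u(3) sum.reindex[OF indep_inj[OF \<sigma>], of "\<lambda>v. u v *\<^sub>R v"] by simp
  finally have "\<forall>j. x j = 0" using \<sigma> sx unfolding indep_def by blast
  moreover obtain i where "i \<in> \<sigma>" "v = a i" using u(1) by blast
  ultimately show False using u(2) by (metis x_def)
qed

lemma indep_card: "indep \<sigma> \<Longrightarrow> card \<sigma> \<le> 3"
  using independent_card_le[OF indep_independent] card_image[OF indep_inj] dim3 by fastforce

lemma indep_span:
  assumes "indep \<sigma>" "card \<sigma> = 3"
  obtains x where "supp_in x \<sigma>" "comb x = v"
proof -
  have "UNIV \<subseteq> span (a ` \<sigma>)"
    using assms dim3 indep_independent[OF assms(1)] card_image[OF indep_inj[OF assms(1)]]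
    by (intro card_ge_dim_independent) auto
  then have "v \<in> span (a ` \<sigma>)" by blast
  then obtain u where "v = (\<Sum>v\<in>a ` \<sigma>. u v *\<^sub>R v)"
    using span_finite[of "a ` \<sigma>"] indep_finite[OF assms(1)] by auto
  then have v: "v = (\<Sum>j\<in>\<sigma>. u (a j) *\<^sub>R a j)"
    using sum.reindex[OF indep_inj[OF assms(1)], of "\<lambda>v. u v *\<^sub>R v"] by simp
  define x where "x = (\<lambda>j. if j \<in> \<sigma> then u (a j) else 0)"
  have sx: "supp_in x \<sigma>" by (auto simp: x_def supp_in_def)
  have "comb x = v"
    unfolding comb_supp[OF sx indep_subset[OF assms(1)]] v by (intro sum.cong) (auto simp: x_def)
  with sx show thesis by (rule that)
qed

lemma frac_pts_mono: "\<sigma> \<subseteq> \<tau> \<Longrightarrow> frac_pts \<sigma> \<subseteq> frac_pts \<tau>"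
  by (auto simp: frac_pts_def intro: supp_in_mono)

lemma frac_pts_complement:
  assumes "x \<in> frac_pts \<sigma>"
  shows "(\<lambda>j. if x j = 0 then 0 else 1 - x j) \<in> frac_pts \<sigma>" (is "?x \<in> _")
proof -
  let ?i = "\<lambda>j. if x j = 0 then 0 else 1 :: real"
  have "?x = (\<lambda>j. ?i j - x j)" by auto
  then have "comb ?x = comb ?i - comb x" using comb_diff[of ?i x] by simp
  moreover have "comb ?i \<in> L" by (intro L_comb) auto
  ultimately have "comb ?x \<in> L" using assms by (auto simp: frac_pts_def intro: L_diff)
  moreover obtain k where "x k \<noteq> 0" "x k < 1" using assms by (auto simp: frac_pts_def)
  then have "?x k \<noteq> 0" by simp
  then have "\<exists>j. ?x j \<noteq> 0" by blast
  moreover have "0 \<le> ?x j \<and> ?x j < 1" for j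
  proof -
    have "0 \<le> x j" "x j < 1" using assms by (auto simp: frac_pts_def)
    then show ?thesis by auto
  qed
  ultimately show ?thesis using assms unfolding frac_pts_def supp_in_def by auto
qed

lemma frac_pts_frac:
  assumes "supp_in z \<sigma>" "comb z \<in> L" "z i \<notin> \<int>"
  shows "(\<lambda>j. frac (z j)) \<in> frac_pts \<sigma>"
proof -
  have "comb (\<lambda>j. frac (z j)) = comb z - comb (\<lambda>j. of_int \<lfloor>z j\<rfloor>)"
    unfolding frac_def by (rule comb_diff)
  moreover have "comb (\<lambda>j. of_int \<lfloor>z j\<rfloor>) \<in> L" by (intro L_comb) auto
  ultimately have "comb (\<lambda>j. frac (z j)) \<in> L" using assms(2) L_diff by simp
  moreover have "frac (z i) \<noteq> 0" using assms(3) by (simp add: frac_eq_0_iff)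
  ultimately show ?thesis using assms(1)
    by (auto simp: frac_pts_def supp_in_def frac_lt_1)
qed

text \<open>The squared norm makes every lattice point on the hull a vertex of the subdivision; the distinct
  powers of \<open>t\<close> make the cost generic.\<close>
definition cost :: "real \<Rightarrow> nat \<Rightarrow> real" where
  "cost t j = - 1 + t * (a j \<bullet> a j + t ^ Suc j)"

text \<open>A dependent tight set \<open>K\<close> carries a relation \<open>x\<close>, and
  tightness forces the sum of \<open>x j * cost t j\<close> to vanish. That sum is a non-zero
  polynomial in \<open>t\<close>, and there are only finitely many \<open>K\<close>.\<close>

lemma cost_generic: "\<forall>\<^sub>F t in at_right 0. generic (cost t)"
proof -
  have "\<forall>\<^sub>F t in at_right 0. \<not> indep K \<longrightarrow>
      (\<exists>x. supp_in x K \<and> comb x = 0 \<and> (\<Sum>j<n. x j * cost t j) \<noteq> 0)" if K: "K \<subseteq> {..<n}" for K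
  proof (cases "indep K")
    case False
    then obtain x k where x: "supp_in x K" "comb x = 0" "x k \<noteq> 0" using K by (auto simp: indep_def)
    have k: "k < n" using x K by (auto simp: supp_in_def)
    define p where "p = (\<Sum>j<n. smult (x j) ([:- 1, a j \<bullet> a j:] + monom 1 (j + 2)))"
    have "poly p t = (\<Sum>j<n. x j * cost t j)" for t
      by (simp add: p_def poly_sum poly_monom cost_def algebra_simps)
    \<comment> \<open>Column \<open>j\<close> is the only one with exponent \<open>j + 2\<close>,
      and the remaining terms have degree at most 1.\<close>
    moreover have "coeff p (k + 2) = (\<Sum>j<n. if k = j then x j else 0)"
      unfolding p_def coeff_sum by (intro sum.cong) auto
    then have "p \<noteq> 0" using k x(3) by auto
    ultimately have "\<forall>\<^sub>F t in at_right 0. (\<Sum>j<n. x j * cost t j) \<noteq> 0"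
      using eventually_poly_nonzero[of p] by simp
    then show ?thesis by eventually_elim (use x in blast)
  qed auto
  then have "\<forall>\<^sub>F t in at_right 0. \<forall>K\<in>Pow {..<n}. \<not> indep K \<longrightarrow>
      (\<exists>x. supp_in x K \<and> comb x = 0 \<and> (\<Sum>j<n. x j * cost t j) \<noteq> 0)"
    by (intro eventually_ball_finite) auto
  then show ?thesis
  proof eventually_elim
    case (elim t)
    show ?case unfolding generic_def
    proof (intro allI impI, rule ccontr)
      fix y assume "feas (cost t) y" and ni: "\<not> indep (tight (cost t) y)"
      have "tight (cost t) y \<in> Pow {..<n}" by (auto simp: tight_def)
      then obtain x where x: "supp_in x (tight (cost t) y)" "comb x = 0" "(\<Sum>j<n. x j * cost t j) \<noteq> 0"
        using elim ni by blast
      have "(\<Sum>j<n. x j * cost t j) = (\<Sum>j<n. x j * (y \<bullet> a j))"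
        using x(1) by (intro sum.cong) (auto simp: supp_in_def tight_def)
      also have "\<dots> = y \<bullet> comb x" by (simp add: inner_comb)
      finally show False using x by simp
    qed
  qed
qed

lemma cost_bounds:
  assumes "0 < \<delta>"
  shows "\<forall>\<^sub>F t in at_right 0. \<forall>j<n. - 1 \<le> cost t j \<and> cost t j \<le> - 1 + \<delta>"
proof -
  have "\<forall>\<^sub>F t in at_right 0. - 1 \<le> cost t j \<and> cost t j \<le> - 1 + \<delta>" for j
  proof -
    have "((\<lambda>t. cost t j) \<longlongrightarrow> - 1 + 0 * (a j \<bullet> a j + 0 ^ Suc j)) (at_right 0)"
      unfolding cost_def by (intro tendsto_intros)
    then have "\<forall>\<^sub>F t in at_right 0. cost t j < - 1 + \<delta>" using assms by (intro order_tendstoD) auto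
    then show ?thesis using eventually_at_right_less[of 0] by eventually_elim (auto simp: cost_def)
  qed
  then have "\<forall>\<^sub>F t in at_right 0. \<forall>j\<in>{..<n}. - 1 \<le> cost t j \<and> cost t j \<le> - 1 + \<delta>"
    by (intro eventually_ball_finite) auto
  then show ?thesis by (rule eventually_mono) auto
qed

text \<open>Strict convexity of the squared norm: the gap is the weighted sum of the squared
  distances to \<open>a j\<close>. A column of positive weight coinciding with \<open>a j\<close>
  would have weight 1 by uniqueness of coordinates.\<close>

lemma convex_gap:
  assumes \<sigma>: "indep \<sigma>" and x: "supp_in x \<sigma>" "\<And>i. 0 \<le> x i" "\<And>i. x i < 1"
    and j: "comb x = a j" and 1: "sz x = 1"
  shows "a j \<bullet> a j < (\<Sum>i<n. x i * (a i \<bullet> a i))"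
proof -
  have eq: "(\<Sum>i<n. x i * ((a i - a j) \<bullet> (a i - a j))) = (\<Sum>i<n. x i * (a i \<bullet> a i)) - a j \<bullet> a j"
  proof -
    have "(\<Sum>i<n. x i * ((a i - a j) \<bullet> (a i - a j)))
        = (\<Sum>i<n. x i * (a i \<bullet> a i) - 2 * (x i * (a j \<bullet> a i)) + x i * (a j \<bullet> a j))"
      by (intro sum.cong) (auto simp: inner_diff inner_commute algebra_simps)
    also have "\<dots> = (\<Sum>i<n. x i * (a i \<bullet> a i)) - 2 * (a j \<bullet> comb x) + sz x * (a j \<bullet> a j)"
      by (simp add: sum.distrib sum_subtractf inner_comb sum_distrib_left sum_distrib_right sz_def)
    finally show ?thesis using j 1 by simp
  qed
  have "\<exists>k<n. x k \<noteq> 0"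
  proof (rule ccontr)
    assume "\<not> ?thesis"
    then have "sz x = 0" by (simp add: sz_def)
    then show False using 1 by simp
  qed
  then obtain k where k: "k < n" "x k \<noteq> 0" by blast
  then have kpos: "0 < x k" using x(2)[of k] by simp
  have "a k \<noteq> a j"
  proof
    assume kj: "a k = a j"
    let ?e = "\<lambda>i. if i = k then 1 else 0 :: real"
    have "comb ?e = comb x" using k kj j by (simp add: comb_single)
    moreover have "k \<in> \<sigma>" using k x(1) by (auto simp: supp_in_def)
    then have "supp_in ?e \<sigma>" by (auto simp: supp_in_def)
    ultimately have "?e = x" by (intro indep_unique[OF \<sigma>] x(1))
    then have "x k = 1" by (metis (mono_tags))
    then show False using x(3)[of k] by simp
  qed
  then have "0 < x k * ((a k - a j) \<bullet> (a k - a j))" using kpos by simp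
  also have "\<dots> \<le> (\<Sum>i<n. x i * ((a i - a j) \<bullet> (a i - a j)))"
    using k x(2) by (intro member_le_sum) auto
  finally show ?thesis unfolding eq by simp
qed

text \<open>For \<open>sz x = 1\<close> the constants \<open>- 1\<close> cancel, and the rest
  divided by \<open>t\<close> tends to the gap of \<open>convex_gap\<close>. Independence leaves at
  most one \<open>x\<close> per \<open>\<sigma>\<close> and \<open>j\<close>, so \<open>t\<close>
  has to meet finitely many conditions only.\<close>

lemma cost_convex:
  "\<forall>\<^sub>F t in at_right 0. \<forall>\<sigma> x j. indep \<sigma> \<longrightarrow> j < n \<longrightarrow> supp_in x \<sigma> \<longrightarrow> (\<forall>i. 0 \<le> x i \<and> x i < 1) \<longrightarrow>
     comb x = a j \<longrightarrow> sz x = 1 \<longrightarrow> cost t j < (\<Sum>i<n. x i * cost t i)"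
  (is "\<forall>\<^sub>F t in _. \<forall>\<sigma> x j. ?P t \<sigma> x j")
proof -
  have "\<forall>\<^sub>F t in at_right 0. \<forall>x. ?P t \<sigma> x j" for \<sigma> j
  proof (cases "indep \<sigma> \<and> j < n \<and> (\<exists>x. supp_in x \<sigma> \<and> (\<forall>i. 0 \<le> x i \<and> x i < 1) \<and> comb x = a j \<and> sz x = 1)")
    case True
    then obtain x where x: "supp_in x \<sigma>" "\<And>i. 0 \<le> x i" "\<And>i. x i < 1" "comb x = a j" "sz x = 1"
      and \<sigma>: "indep \<sigma>" by auto
    let ?f = "\<lambda>t. (\<Sum>i<n. x i * (a i \<bullet> a i + t ^ Suc i)) - (a j \<bullet> a j + t ^ Suc j)"
    have "(?f \<longlongrightarrow> ?f 0) (at_right 0)" by (intro tendsto_intros)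
    moreover have "0 < ?f 0" using convex_gap[OF \<sigma> x] by simp
    ultimately have "\<forall>\<^sub>F t in at_right 0. 0 < ?f t" by (rule order_tendstoD)
    then show ?thesis using eventually_at_right_less[of 0]
    proof eventually_elim
      case (elim t)
      have "(\<Sum>i<n. x i * cost t i) = - sz x + t * (\<Sum>i<n. x i * (a i \<bullet> a i + t ^ Suc i))"
        by (simp add: cost_def algebra_simps sum.distrib sum_negf sum_distrib_left sz_def sum_subtractf)
      then have "(\<Sum>i<n. x i * cost t i) - cost t j = t * ?f t"
        using x(5) by (simp add: cost_def algebra_simps)
      moreover have "0 < t * ?f t" using elim by (intro mult_pos_pos) auto
      ultimately have "cost t j < (\<Sum>i<n. x i * cost t i)" by linarith
      then show ?case using indep_unique[OF \<sigma> x(1)] x(4) by metis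
    qed
  next
    case False
    then have "\<forall>t x. ?P t \<sigma> x j" by blast
    then show ?thesis by (intro always_eventually) blast
  qed
  then have "\<forall>\<^sub>F t in at_right 0. \<forall>\<sigma>\<in>Pow {..<n}. \<forall>j\<in>{..<n}. \<forall>x. ?P t \<sigma> x j"
    by (intro eventually_ball_finite ballI) auto
  then show ?thesis by eventually_elim (auto dest: indep_subset)
qed

text \<open>Heights of columns that differ from 1 thus keep a positive distance from 1, which
  decides how small the perturbation must be.\<close>

lemma finite_sizes: "finite {sz x |x \<sigma> j. indep \<sigma> \<and> supp_in x \<sigma> \<and> j < n \<and> comb x = a j}"
proof -
  have "finite {sz x |x. indep \<sigma> \<and> supp_in x \<sigma> \<and> comb x = a j}" for \<sigma> j
  proof (cases "\<exists>x. indep \<sigma> \<and> supp_in x \<sigma> \<and> comb x = a j")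
    case True
    then obtain x where x: "indep \<sigma>" "supp_in x \<sigma>" "comb x = a j" by blast
    have "{sz x |x. indep \<sigma> \<and> supp_in x \<sigma> \<and> comb x = a j} \<subseteq> {sz x}"
      using indep_unique[OF x(1) _ x(2)] x(3) by auto
    then show ?thesis by (rule finite_subset) simp
  next
    case False
    then have "{sz x |x. indep \<sigma> \<and> supp_in x \<sigma> \<and> comb x = a j} = {}" by blast
    then show ?thesis by (simp only: finite.emptyI)
  qed
  then have "finite (\<Union>\<sigma>\<in>Pow {..<n}. \<Union>j<n. {sz x |x. indep \<sigma> \<and> supp_in x \<sigma> \<and> comb x = a j})"
    by (intro finite_UN_I) auto
  then show ?thesis by (rule rev_finite_subset) (use indep_subset in blast)
qed

text \<open>The lower hull of the columns, refined so that all lattice points of height one are used. The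
  heights of a fractional point and of its complement both exceed 1 and add up to the number of
  columns involved, and a lattice point of height less than 2 is irreducible, hence a column.\<close>
lemma hull_cost:
  obtains c where "generic c" "\<And>j. j < n \<Longrightarrow> c j \<in> \<rat>"
    "\<And>y x. feas c y \<Longrightarrow> x \<in> frac_pts (tight c y) \<Longrightarrow>
       card (tight c y) = 3 \<and> (\<forall>j\<in>tight c y. 0 < x j) \<and> 1 < sz x \<and> sz x < 2 \<and> (\<exists>j<n. comb x = a j)"
proof -
  define V where "V = {sz x |x \<sigma> j. indep \<sigma> \<and> supp_in x \<sigma> \<and> j < n \<and> comb x = a j}"
  obtain \<eta> where \<eta>: "0 < \<eta>" "\<And>v. v \<in> V \<Longrightarrow> v \<noteq> 1 \<Longrightarrow> \<eta> \<le> dist 1 v"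
    using finite_set_avoid[OF finite_sizes, of 1] unfolding V_def by blast
  \<comment> \<open>\<open>3 * \<delta> <= \<eta>\<close> beats the errors \<open>\<delta>\<close>
    and \<open>2 * \<delta>\<close> in the two uses of the gap around 1, and
    \<open>\<delta> < 1 / 4\<close> separates \<open>1 + 2 * \<delta>\<close> from
    \<open>2 - 2 * \<delta>\<close>.\<close>
  define \<delta> where "\<delta> = min (\<eta> / 3) (1 / 8)"
  have \<delta>: "0 < \<delta>" "\<delta> \<le> 1 / 8" "3 * \<delta> \<le> \<eta>" using \<eta>(1) by (auto simp: \<delta>_def)
  have "\<forall>\<^sub>F t in at_right 0. generic (cost t) \<and> (\<forall>j<n. - 1 \<le> cost t j \<and> cost t j \<le> - 1 + \<delta>)
     \<and> (\<forall>\<sigma> x j. indep \<sigma> \<longrightarrow> j < n \<longrightarrow> supp_in x \<sigma> \<longrightarrow> (\<forall>i. 0 \<le> x i \<and> x i < 1) \<longrightarrow>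
       comb x = a j \<longrightarrow> sz x = 1 \<longrightarrow> cost t j < (\<Sum>i<n. x i * cost t i))"
    using cost_generic cost_bounds[OF \<delta>(1)] cost_convex by eventually_elim blast
  then obtain b where b: "0 < b" and bt: "\<And>t. 0 < t \<Longrightarrow> t < b \<Longrightarrow> generic (cost t) \<and> (\<forall>j<n. - 1 \<le> cost t j \<and> cost t j \<le> - 1 + \<delta>)
     \<and> (\<forall>\<sigma> x j. indep \<sigma> \<longrightarrow> j < n \<longrightarrow> supp_in x \<sigma> \<longrightarrow> (\<forall>i. 0 \<le> x i \<and> x i < 1) \<longrightarrow>
       comb x = a j \<longrightarrow> sz x = 1 \<longrightarrow> cost t j < (\<Sum>i<n. x i * cost t i))"
    unfolding eventually_at_right_field by blast
  \<comment> \<open>A rational \<open>t\<close> keeps the costs rational, so that denominators can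
    be cleared at the end.\<close>
  obtain t where t: "t \<in> \<rat>" "0 < t" "t < b" using Rats_dense_in_real[OF b] by blast
  define c where "c = cost t"
  have gen: "generic c" and cb: "\<And>j. j < n \<Longrightarrow> - 1 \<le> c j \<and> c j \<le> - 1 + \<delta>"
    and conv: "\<And>\<sigma> x j. indep \<sigma> \<Longrightarrow> j < n \<Longrightarrow> supp_in x \<sigma> \<Longrightarrow> (\<forall>i. 0 \<le> x i \<and> x i < 1) \<Longrightarrow>
       comb x = a j \<Longrightarrow> sz x = 1 \<Longrightarrow> c j < (\<Sum>i<n. x i * c i)"
    using bt[OF t(2,3)] unfolding c_def by blast+
  have rat: "c j \<in> \<rat>" if "j < n" for j
    unfolding c_def cost_def using t(1) norm_Rats[OF that]
    by (intro Rats_add Rats_mult Rats_power) (auto intro: Rats_minus_iff[THEN iffD2])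
  \<comment> \<open>Normality rewrites the point with natural coefficients \<open>u\<close>, and
    comparing values under \<open>y\<close> shows that its height is at least
    \<open>1 - \<delta>\<close> times the sum of \<open>u\<close>. The sum 0 is impossible, 1 means
    a column, and from 2 on the height is at least \<open>2 - 2 * \<delta>\<close>.\<close>
  have key: "1 < sz x \<and> (sz x < 2 - 2 * \<delta> \<longrightarrow> (\<exists>j<n. comb x = a j))"
    if y: "feas c y" and x: "x \<in> frac_pts (tight c y)" for y x
  proof -
    let ?\<sigma> = "tight c y"
    have \<sigma>: "indep ?\<sigma>" using gen y by (simp add: generic_def)
    have sx: "supp_in x ?\<sigma>" and x01: "\<forall>i. 0 \<le> x i \<and> x i < 1" and xL: "comb x \<in> L" and xn: "\<exists>j. x j \<noteq> 0"
      using x by (auto simp: frac_pts_def)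
    have "\<forall>j<n. 0 \<le> x j" using x01 by blast
    then obtain u where u: "comb x = comb (\<lambda>j. real (u j))"
      using normal[of x] xL unfolding comb_def by blast
    have yx: "y \<bullet> comb x = (\<Sum>j<n. x j * c j)"
      unfolding inner_comb using sx by (intro sum.cong) (auto simp: supp_in_def tight_def)
    have "- sz x = (\<Sum>j<n. x j * - 1)" by (simp add: sz_def sum_negf)
    also have "\<dots> \<le> (\<Sum>j<n. x j * c j)" using x01 cb by (intro sum_mono mult_left_mono) auto
    finally have 1: "- sz x \<le> y \<bullet> comb x" by (simp add: yx)
    have "y \<bullet> comb x = (\<Sum>j<n. real (u j) * (y \<bullet> a j))" unfolding u by (rule inner_comb)
    also have "\<dots> \<le> (\<Sum>j<n. real (u j) * (- 1 + \<delta>))"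
    proof (intro sum_mono mult_left_mono)
      fix j assume "j \<in> {..<n}"
      then show "y \<bullet> a j \<le> - 1 + \<delta>" using y cb[of j] by (auto simp: feas_def intro: order_trans)
    qed simp
    also have "\<dots> = real (\<Sum>j<n. u j) * (- 1 + \<delta>)" by (simp add: sum_distrib_right)
    finally have le: "real (\<Sum>j<n. u j) * (1 - \<delta>) \<le> sz x" using 1 by (simp add: algebra_simps)
    consider "(\<Sum>j<n. u j) = 0" | "(\<Sum>j<n. u j) = 1" | "2 \<le> (\<Sum>j<n. u j)" by linarith
    then show ?thesis
    proof cases
      case 1
      then have "comb x = 0" unfolding u by (simp add: comb_def)
      then have False using \<sigma> sx xn unfolding indep_def by blast
      then show ?thesis ..
    next
      case 2
      then obtain k where k: "k < n" "u k = 1" "\<forall>j\<in>{..<n} - {k}. u j = 0"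
        using sum_eq_1_iff[of "{..<n}" u] by auto
      have "comb (\<lambda>j. real (u j)) = comb (\<lambda>j. if j = k then 1 else 0)"
        using k by (intro comb_cong) auto
      then have xk: "comb x = a k" using k u by (simp add: comb_single)
      have "sz x \<in> V" unfolding V_def using \<sigma> sx k xk by blast
      moreover have "sz x \<noteq> 1"
      proof
        assume "sz x = 1"
        then have "c k < y \<bullet> comb x" unfolding yx using conv[OF \<sigma> k(1) sx x01 xk] by simp
        then show False using y k xk by (auto simp: feas_def)
      qed
      ultimately have "\<eta> \<le> \<bar>1 - sz x\<bar>" using \<eta>(2) by (auto simp: dist_real_def)
      then have "1 < sz x" using le 2 \<delta> by auto
      then show ?thesis using k xk by blast
    next
      case 3
      then have "2 * (1 - \<delta>) \<le> real (\<Sum>j<n. u j) * (1 - \<delta>)"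
        using \<delta> by (intro mult_right_mono) (auto simp del: of_nat_sum)
      then have "2 - 2 * \<delta> \<le> sz x" using le by simp
      then show ?thesis using \<delta> by auto
    qed
  qed
  have main: "card (tight c y) = 3 \<and> (\<forall>j\<in>tight c y. 0 < x j) \<and> 1 < sz x \<and> sz x < 2 \<and> (\<exists>j<n. comb x = a j)"
    if y: "feas c y" and x: "x \<in> frac_pts (tight c y)" for y x
  proof -
    let ?\<sigma> = "tight c y"
    have \<sigma>: "indep ?\<sigma>" using gen y by (simp add: generic_def)
    define x' where "x' = (\<lambda>j. if x j = 0 then 0 else 1 - x j)"
    have x': "x' \<in> frac_pts ?\<sigma>" unfolding x'_def by (rule frac_pts_complement[OF x])
    define S where "S = {j\<in>?\<sigma>. x j \<noteq> 0}"
    have sx: "supp_in x ?\<sigma>" "supp_in x' ?\<sigma>" using x x' by (auto simp: frac_pts_def)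
    have "sz x + sz x' = (\<Sum>j\<in>?\<sigma>. x j + x' j)"
      using sx indep_subset[OF \<sigma>] by (simp add: sz_supp sum.distrib)
    also have "\<dots> = (\<Sum>j\<in>?\<sigma>. if x j \<noteq> 0 then 1 else 0)" by (intro sum.cong) (auto simp: x'_def)
    also have "\<dots> = real (card S)" using indep_finite[OF \<sigma>] by (simp add: S_def sum.If_cases Int_def)
    finally have sum: "sz x + sz x' = real (card S)" .
    have gt: "1 < sz x" "1 < sz x'" using key[OF y x] key[OF y x'] by auto
    then have "2 < card S" using sum by linarith
    moreover have SS: "S \<subseteq> ?\<sigma>" by (auto simp: S_def)
    ultimately have S: "S = ?\<sigma>" "card S = 3"
      using indep_card[OF \<sigma>] card_mono[OF indep_finite[OF \<sigma>] SS] card_subset_eq[OF indep_finite[OF \<sigma>] SS] by auto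
    have "0 < x j" if "j \<in> ?\<sigma>" for j
    proof -
      have "x j \<noteq> 0" using that S(1) unfolding S_def by blast
      moreover have "0 \<le> x j" using x by (auto simp: frac_pts_def)
      ultimately show ?thesis by simp
    qed
    \<comment> \<open>If the point is no column, its height is nearly 2 and that of its complement
      nearly 1; the complement is then a column whose height violates the gap around 1.\<close>
    moreover have "\<exists>j<n. comb x = a j"
    proof (rule ccontr)
      assume "\<nexists>j. j < n \<and> comb x = a j"
      then have "2 - 2 * \<delta> \<le> sz x" using key[OF y x] by (meson not_le)
      then have small: "sz x' \<le> 1 + 2 * \<delta>" using sum S by simp
      then have "sz x' < 2 - 2 * \<delta>" using \<delta> by simp
      then obtain j where "j < n" "comb x' = a j" using key[OF y x'] by blast
      then have "sz x' \<in> V" unfolding V_def using \<sigma> sx by blast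
      then have "\<eta> \<le> dist 1 (sz x')" using gt by (intro \<eta>(2)) auto
      then show False using small gt \<delta> unfolding dist_real_def by linarith
    qed
    ultimately show ?thesis using gt sum S by auto
  qed
  show thesis using gen rat main by (rule that)
qed

end

subsection \<open>Star subdivision\<close>

lemma frac_of_nat_div:
  assumes "0 < q"
  shows "frac (real m / real q) = real (m mod q) / real q"
proof -
  have "real m = real (m div q) * real q + real (m mod q)"
    by (metis div_mult_mod_eq of_nat_add of_nat_mult)
  then have "real m / real q = real (m div q) + real (m mod q) / real q"
    using assms by (simp add: field_simps)
  then show ?thesis unfolding frac_def floor_divide_of_nat_eq by simp
qed

context column_config
begin

text \<open>The condition \<open>x u + x v = 1\<close> puts all fractional points at lattice height one over the ray
  \<open>e\<close>, so that star subdivision at a lowest one preserves the situation.\<close>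
definition flat :: "nat set \<Rightarrow> bool" where
  "flat \<sigma> \<longleftrightarrow> frac_pts \<sigma> = {} \<or>
     (\<exists>u v e. u \<noteq> v \<and> u \<noteq> e \<and> v \<noteq> e \<and> \<sigma> = {u, v, e} \<and>
       (\<forall>x\<in>frac_pts \<sigma>. x u + x v = 1 \<and> 0 < x e \<and> (\<exists>j<n. comb x = a j)))"

lemma finite_frac_pts:
  assumes "indep \<sigma>" "\<forall>x\<in>frac_pts \<sigma>. \<exists>j<n. comb x = a j"
  shows "finite (frac_pts \<sigma>)"
proof (rule inj_on_finite)
  show "inj_on comb (frac_pts \<sigma>)"
    by (rule inj_onI, rule indep_unique[OF assms(1)]) (auto simp: frac_pts_def)
  show "comb ` frac_pts \<sigma> \<subseteq> a ` {..<n}" using assms(2) by force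
qed simp

lemma frac_pts_minimal:
  assumes "indep \<sigma>" "\<forall>x\<in>frac_pts \<sigma>. \<exists>j<n. comb x = a j" "frac_pts \<sigma> \<noteq> {}"
  obtains g where "g \<in> frac_pts \<sigma>" "\<And>x. x \<in> frac_pts \<sigma> \<Longrightarrow> g e \<le> x e"
proof -
  have "finite ((\<lambda>x. x e) ` frac_pts \<sigma>)" using finite_frac_pts[OF assms(1,2)] by simp
  then have m: "Min ((\<lambda>x. x e) ` frac_pts \<sigma>) \<in> (\<lambda>x. x e) ` frac_pts \<sigma>"
    and le: "\<And>x. x \<in> frac_pts \<sigma> \<Longrightarrow> Min ((\<lambda>x. x e) ` frac_pts \<sigma>) \<le> x e"
    using assms(3) by (auto intro: Min_in)
  obtain g where "g \<in> frac_pts \<sigma>" "Min ((\<lambda>x. x e) ` frac_pts \<sigma>) = g e" using m by (rule imageE)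
  then show thesis using le that by simp
qed

text \<open>A fractional point with minimal third coordinate generates the others modulo integer vectors.\<close>
lemma flat_of_heights:
  assumes \<sigma>: "indep \<sigma>" and card: "card \<sigma> = 3"
    and H: "\<And>x. x \<in> frac_pts \<sigma> \<Longrightarrow> (\<forall>j\<in>\<sigma>. 0 < x j) \<and> 1 < sz x \<and> sz x < 2 \<and> (\<exists>j<n. comb x = a j)"
  shows "flat \<sigma>"
proof (cases "frac_pts \<sigma> = {}")
  case False
  obtain p1 p2 p3 where p: "\<sigma> = {p1, p2, p3}" "p1 \<noteq> p2" "p1 \<noteq> p3" "p2 \<noteq> p3"
    using card by (auto simp: card_3_iff)
  have sz3: "sz x = x p1 + x p2 + x p3" if "supp_in x \<sigma>" for x
    using sz_supp[OF that indep_subset[OF \<sigma>]] p by simp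
  obtain g where g: "g \<in> frac_pts \<sigma>" and gmin: "\<And>x. x \<in> frac_pts \<sigma> \<Longrightarrow> g p3 \<le> x p3"
    using frac_pts_minimal[OF \<sigma> _ False, of p3] H by blast
  have g01: "0 < g j" "g j < 1" if "j \<in> \<sigma>" for j using H[OF g] g that by (auto simp: frac_pts_def)
  have sg: "supp_in g \<sigma>" and gL: "comb g \<in> L" using g by (auto simp: frac_pts_def)
  define m where "m = g p3"
  have m: "0 < m" "m < 1" using g01 p by (auto simp: m_def)
  have ints: "z j \<in> \<int>" if z: "supp_in z \<sigma>" "comb z \<in> L" and z3: "frac (z p3) < m" for z j
  proof (rule ccontr)
    assume "z j \<notin> \<int>"
    then have "(\<lambda>j. frac (z j)) \<in> frac_pts \<sigma>" using z by (intro frac_pts_frac)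
    from gmin[OF this] z3 show False by (simp add: m_def)
  qed
  \<comment> \<open>Division with remainder by the least third coordinate \<open>m\<close>: after
    subtracting \<open>k\<close> times \<open>g\<close> that coordinate is below \<open>m\<close>,
    so by minimality the remainder is integral.\<close>
  have gen: "\<exists>k::int. (0 \<le> z p3 - real_of_int k * m \<and> z p3 - real_of_int k * m < m) \<and> (\<forall>j. z j - real_of_int k * g j \<in> \<int>)"
    if z: "supp_in z \<sigma>" "comb z \<in> L" for z
  proof -
    define k where "k = \<lfloor>z p3 / m\<rfloor>"
    have "real_of_int k \<le> z p3 / m" "z p3 / m < real_of_int k + 1" by (simp_all add: k_def)
    then have b: "0 \<le> z p3 - real_of_int k * m" "z p3 - real_of_int k * m < m"
      using m by (simp_all add: pos_le_divide_eq pos_divide_less_eq algebra_simps)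
    let ?w = "\<lambda>j. z j - real_of_int k * g j"
    have "supp_in ?w \<sigma>" using z sg by (auto simp: supp_in_def)
    moreover have "comb ?w \<in> L" unfolding comb_diff comb_scale using z gL by (intro L_diff L_of_int)
    moreover have "frac (?w p3) < m"
    proof -
      have "frac (?w p3) = ?w p3" using b m by (subst frac_eq) (auto simp: m_def)
      then show ?thesis using b by (simp add: m_def)
    qed
    ultimately have "\<forall>j. ?w j \<in> \<int>" using ints by blast
    then show ?thesis using b by blast
  qed
  \<comment> \<open>For a unit vector the remainder \<open>1 - k * m\<close> is an integer in
    \<open>[0, m)\<close>, hence 0, so \<open>m\<close> is the reciprocal of an integer.\<close>
  obtain Q :: int where Q: "real_of_int Q * m = 1"
  proof -
    let ?e = "\<lambda>j. if j = p3 then 1 else 0 :: real"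
    have "supp_in ?e \<sigma>" "comb ?e \<in> L" using p by (auto simp: supp_in_def intro!: L_comb)
    then obtain k :: int where k: "0 \<le> 1 - real_of_int k * m" "1 - real_of_int k * m < m"
        "\<forall>j. ?e j - real_of_int k * g j \<in> \<int>"
      using gen[of ?e] by auto
    have "1 - real_of_int k * m \<in> \<int>" using k(3)[rule_format, of p3] by (simp add: m_def)
    then obtain i where "1 - real_of_int k * m = real_of_int i" by (rule Ints_cases)
    then have "i = 0" using k m by linarith
    then show thesis using that[of k] \<open>1 - real_of_int k * m = real_of_int i\<close> by simp
  qed
  have Qpos: "1 < real_of_int Q"
  proof (rule ccontr)
    assume "\<not> 1 < real_of_int Q"
    then have "real_of_int Q * m \<le> 1 * m" using m by (intro mult_right_mono) auto
    then show False using Q m by simp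
  qed
  define q where "q = nat Q"
  have q: "2 \<le> q" "real q = real_of_int Q" using Qpos by (auto simp: q_def)
  have qm: "real q * m = 1" using Q q by simp
  have qg: "real q * g j \<in> \<int>" for j
  proof -
    have "supp_in (\<lambda>j. real q * g j) \<sigma>" using sg by (auto simp: supp_in_def)
    moreover have "comb (\<lambda>j. real q * g j) \<in> L" unfolding comb_scale by (intro L_of_nat gL)
    moreover have "frac (real q * g p3) < m" using qm m by (simp add: m_def)
    ultimately show ?thesis using ints by blast
  qed
  have nat: "\<exists>a. g j = real a / real q \<and> a < q" if "j \<in> \<sigma>" for j
  proof -
    obtain i where i: "real q * g j = real_of_int i" using qg[of j] by (rule Ints_cases)
    have "0 < real_of_int i" unfolding i[symmetric] using g01(1)[OF that] q by simp
    moreover have "real_of_int i < real q"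
    proof -
      have "real q * g j < real q * 1" using g01(2)[OF that] q by (intro mult_strict_left_mono) auto
      then show ?thesis using i by simp
    qed
    ultimately have "real q * g j = real (nat i)" "nat i < q" using i by auto
    then show ?thesis using q by (intro exI[of _ "nat i"]) (auto simp: field_simps)
  qed
  obtain a1 a2 where a1: "g p1 = real a1 / real q" "a1 < q" and a2: "g p2 = real a2 / real q" "a2 < q"
    using nat[of p1] nat[of p2] p by auto
  have g3: "g p3 = 1 / real q" using qm q by (simp add: m_def field_simps)
  \<comment> \<open>The fractional parts of \<open>k * g\<close> have the coordinates
    \<open>k * a1 mod q\<close>, \<open>k * a2 mod q\<close> and \<open>k\<close>, all over
    \<open>q\<close>; their heights between 1 and 2 give the hypotheses of
    \<open>terminal_lemma\<close>.\<close>
  have mult: "0 < k * a1 mod q \<and> 0 < k * a2 mod q \<and> q < k * a1 mod q + k * a2 mod q + k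
      \<and> k * a1 mod q + k * a2 mod q + k < 2 * q" if k: "1 \<le> k" "k < q" for k
  proof -
    let ?z = "\<lambda>j. real k * g j"
    have f1: "frac (?z p1) = real (k * a1 mod q) / real q" "frac (?z p2) = real (k * a2 mod q) / real q"
      using frac_of_nat_div[of q "k * a1"] frac_of_nat_div[of q "k * a2"] q by (simp_all add: a1 a2)
    have f3: "frac (?z p3) = real k / real q"
      using frac_of_nat_div[of q k] q k by (simp add: g3)
    then have "?z p3 \<notin> \<int>" using k q by (auto simp: frac_eq_0_iff[symmetric])
    moreover have "supp_in ?z \<sigma>" using sg by (auto simp: supp_in_def)
    moreover have "comb ?z \<in> L" unfolding comb_scale by (intro L_of_nat gL)
    ultimately have fz: "(\<lambda>j. frac (?z j)) \<in> frac_pts \<sigma>" using frac_pts_frac by blast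
    have "supp_in (\<lambda>j. frac (?z j)) \<sigma>" using fz by (simp add: frac_pts_def)
    from sz3[OF this] have s: "sz (\<lambda>j. frac (?z j)) = (real (k * a1 mod q) + real (k * a2 mod q) + real k) / real q"
      unfolding f1 f3 by (simp add: add_divide_distrib)
    have "0 < frac (?z p1)" "0 < frac (?z p2)" using H[OF fz] p by auto
    then have "0 < real (k * a1 mod q)" "0 < real (k * a2 mod q)" unfolding f1 using q
      by (auto simp: zero_less_divide_iff)
    moreover have "1 < sz (\<lambda>j. frac (?z j))" "sz (\<lambda>j. frac (?z j)) < 2" using H[OF fz] by auto
    then have "real q < real (k * a1 mod q) + real (k * a2 mod q) + real k"
      "real (k * a1 mod q) + real (k * a2 mod q) + real k < 2 * real q"
      unfolding s using q by (simp_all add: less_divide_eq divide_less_eq)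
    ultimately show ?thesis by linarith
  qed
  have "a1 + a2 = q \<or> a1 + 1 = q \<or> a2 + 1 = q"
    using q(1) a1(2) a2(2) by (rule terminal_lemma) (use mult in auto)
  then have pair: "g p1 + g p2 = 1 \<or> g p1 + g p3 = 1 \<or> g p2 + g p3 = 1"
    using q unfolding a1 a2 g3 by (auto simp: add_divide_distrib[symmetric])
  \<comment> \<open>Every fractional point is a multiple of \<open>g\<close> modulo integers, so two
    coordinates with sum 1 in \<open>g\<close> have an integral sum in it, and this sum lies
    strictly between 0 and 2.\<close>
  have pair_sum: "x i + x j = 1" if ij: "i \<in> \<sigma>" "j \<in> \<sigma>" "g i + g j = 1" and x: "x \<in> frac_pts \<sigma>" for i j x
  proof -
    have "supp_in x \<sigma>" "comb x \<in> L" using x by (auto simp: frac_pts_def)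
    then obtain k :: int where k: "\<And>j. x j - real_of_int k * g j \<in> \<int>" using gen by blast
    have "(x i - real_of_int k * g i) + (x j - real_of_int k * g j) + real_of_int k \<in> \<int>"
      by (intro Ints_add k Ints_of_int)
    moreover have "(x i - real_of_int k * g i) + (x j - real_of_int k * g j) + real_of_int k
        = x i + x j - real_of_int k * (g i + g j) + real_of_int k" by (simp add: algebra_simps)
    ultimately have "x i + x j \<in> \<int>" using ij by simp
    then obtain w where w: "x i + x j = real_of_int w" by (rule Ints_cases)
    have "0 < x i" "0 < x j" "x i < 1" "x j < 1" using H[OF x] x ij by (auto simp: frac_pts_def)
    then have "w = 1" using w by linarith
    then show ?thesis using w by simp
  qed
  have flatI: "flat \<sigma>"
    if "g i + g j = 1" "{i, j, l} = \<sigma>" "i \<noteq> j" "i \<noteq> l" "j \<noteq> l" for i j l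
  proof -
    have "x i + x j = 1 \<and> 0 < x l \<and> (\<exists>j<n. comb x = a j)" if "x \<in> frac_pts \<sigma>" for x
      using pair_sum[of i j x] H[OF that] that \<open>g i + g j = 1\<close> \<open>{i, j, l} = \<sigma>\<close> by blast
    then show ?thesis unfolding flat_def using that by metis
  qed
  from pair show ?thesis
    using flatI[of p1 p2 p3] flatI[of p1 p3 p2] flatI[of p2 p3 p1] p by blast
qed (simp add: flat_def)

section \<open>Star subdivision of a single cone\<close>

lemma indep_mono: "indep \<tau> \<Longrightarrow> \<sigma> \<subseteq> \<tau> \<Longrightarrow> indep \<sigma>"
  unfolding indep_def by (meson supp_in_mono subset_trans)

text \<open>Coordinates are unique, and a column of \<open>\<sigma>\<close> has one equal to
  1.\<close>

lemma vertex_not_frac: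
  assumes \<sigma>: "indep \<sigma>" and x: "x \<in> frac_pts \<sigma>" "comb x = a k"
  shows "k \<notin> \<sigma>"
proof
  assume k: "k \<in> \<sigma>"
  then have kn: "k < n" using indep_subset[OF \<sigma>] by blast
  let ?e = "\<lambda>i. if i = k then 1 else 0 :: real"
  have "comb ?e = comb x" using kn x by (simp add: comb_single)
  moreover have "supp_in ?e \<sigma>" using k by (auto simp: supp_in_def)
  ultimately have "?e = x" using x by (intro indep_unique[OF \<sigma>]) (auto simp: frac_pts_def)
  then have "x k = 1" by (metis (mono_tags))
  moreover have "x k < 1" using x by (simp add: frac_pts_def)
  ultimately show False by simp
qed

text \<open>Coordinates relative to \<open>T\<close> of a combination of \<open>k\<close> and \<open>T\<close>, where column \<open>k\<close> has
  coordinates \<open>x\<close>.\<close>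
definition subst_coord :: "nat \<Rightarrow> (nat \<Rightarrow> real) \<Rightarrow> (nat \<Rightarrow> real) \<Rightarrow> nat \<Rightarrow> real" where
  "subst_coord k x z = (\<lambda>i. (if i = k then 0 else z i) + z k * x i)"

lemma comb_subst_coord:
  assumes "k < n" "comb x = a k"
  shows "comb (subst_coord k x z) = comb z"
proof -
  have "subst_coord k x z = (\<lambda>i. z i - (if i = k then z k else 0) + z k * x i)"
    by (auto simp: subst_coord_def)
  then have "comb (subst_coord k x z) = comb z - z k *\<^sub>R a k + z k *\<^sub>R comb x"
    by (simp only: comb_add comb_diff comb_scale comb_single[OF assms(1)])
  then show ?thesis using assms by simp
qed

lemma supp_subst_coord:
  assumes "supp_in x T" "supp_in z (insert k T)" "k \<notin> T"
  shows "supp_in (subst_coord k x z) T"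
  using assms by (auto simp: supp_in_def subst_coord_def)

text \<open>The exchange argument: in the coordinates of \<open>T\<close>, a relation sees at
  \<open>j\<close> only the coefficient of \<open>k\<close>, which therefore vanishes.\<close>

lemma indep_star:
  assumes T: "indep T" and k: "k < n" "k \<notin> T" and x: "supp_in x T" "comb x = a k"
    and j: "j \<in> T" "x j \<noteq> 0"
  shows "indep (insert k (T - {j}))"
  unfolding indep_def
proof (intro conjI allI impI)
  show "insert k (T - {j}) \<subseteq> {..<n}" using k indep_subset[OF T] by auto
  fix z i assume z: "supp_in z (insert k (T - {j}))" "comb z = 0"
  have "supp_in (subst_coord k x z) T"
    using k x z by (intro supp_subst_coord) (auto intro: supp_in_mono)
  moreover have "comb (subst_coord k x z) = 0" using comb_subst_coord[OF k(1) x(2)] z by simp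
  ultimately have w: "\<forall>i. subst_coord k x z i = 0" using T unfolding indep_def by blast
  have "z j = 0" "j \<noteq> k" using z j k by (auto simp: supp_in_def)
  then have zk: "z k = 0" using w[rule_format, of j] j by (simp add: subst_coord_def)
  then show "z i = 0" using w[rule_format, of i] by (cases "i = k") (auto simp: subst_coord_def)
qed

text \<open>Lowering the cost of column \<open>k\<close> to slightly less than the height of the cone \<open>T\<close> over it.\<close>
lemma star:
  assumes gen: "generic c" and rat: "\<And>j. j < n \<Longrightarrow> c j \<in> \<rat>"
    and yT: "feas c yT" and card: "card (tight c yT) = 3"
    and k: "k < n" "k \<notin> tight c yT"
    and x: "supp_in x (tight c yT)" "comb x = a k" "\<And>j. j \<in> tight c yT \<Longrightarrow> 0 < x j"
  obtains c' where "generic c'" "\<And>j. j < n \<Longrightarrow> c' j \<in> \<rat>"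
    "\<And>y. feas c' y \<Longrightarrow> feas c y \<and> y \<bullet> a k < yT \<bullet> a k"
    "\<And>y. feas c' y \<Longrightarrow> tight c' y = tight c y \<or> (\<exists>j\<in>tight c yT. tight c' y \<subseteq> insert k (tight c yT - {j}))"
proof -
  define T where "T = tight c yT"
  have T: "indep T" using gen yT by (simp add: generic_def T_def)
  note Tn = indep_subset[OF T]
  have fT: "finite T" by (rule indep_finite[OF T])
  have tT: "yT \<bullet> a j = c j" if "j \<in> T" for j using that by (simp add: T_def tight_def)
  define g where "g = yT \<bullet> a k"
  have inner_T: "y \<bullet> comb z = (\<Sum>j\<in>T. z j * (y \<bullet> a j))" if "supp_in z T" for y z
    unfolding comb_supp[OF that Tn] by (simp add: inner_sum_right)
  have sx: "supp_in x T" using x by (simp add: T_def)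
  have xpos: "0 < x j" if "j \<in> T" for j using x(3) that by (simp add: T_def)
  have gsum: "g = (\<Sum>j\<in>T. x j * c j)"
    unfolding g_def x(2)[symmetric] inner_T[OF sx] by (intro sum.cong) (auto simp: tT)
  have gk: "g < c k" using yT k by (auto simp: g_def feas_def tight_def less_le)
  have le: "\<And>y j. feas c y \<Longrightarrow> j \<in> T \<Longrightarrow> y \<bullet> a j \<le> c j" using Tn by (auto simp: feas_def)
  have "\<forall>\<^sub>F \<eta> in at_right 0. \<forall>y. feas c y \<longrightarrow> y \<bullet> a k = g - \<eta> \<longrightarrow> y \<bullet> a i < c i" if i: "i < n" "i \<notin> T" for i
  proof -
    \<comment> \<open>If \<open>y . a k = g - \<eta>\<close>, the slacks of \<open>y\<close> on
      \<open>T\<close> are at most \<open>\<eta> / x j\<close>. As \<open>T\<close> is a basis, this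
      bounds the rise from \<open>yT\<close> to \<open>y\<close> on any other column by
      \<open>\<eta> * M\<close>, too little to reach \<open>c i\<close> when
      \<open>\<eta> < D / (M + 1)\<close>.\<close>
    obtain \<rho> where \<rho>: "supp_in \<rho> T" "comb \<rho> = a i" using indep_span[OF T] card T_def by metis
    define M where "M = (\<Sum>j\<in>T. \<bar>\<rho> j\<bar> / x j)"
    have M: "0 \<le> M" unfolding M_def using xpos by (intro sum_nonneg) (auto simp: less_imp_le)
    define D where "D = c i - yT \<bullet> a i"
    have D: "0 < D" using yT i by (auto simp: D_def T_def feas_def tight_def less_le)
    have "y \<bullet> a i < c i" if \<eta>: "0 < \<eta>" "\<eta> < D / (M + 1)" and y: "feas c y" "y \<bullet> a k = g - \<eta>" for \<eta> y
    proof -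
      have "(\<Sum>j\<in>T. x j * (c j - y \<bullet> a j)) = g - y \<bullet> a k"
        unfolding gsum x(2)[symmetric] inner_T[OF sx] by (simp add: right_diff_distrib sum_subtractf)
      then have s: "(\<Sum>j\<in>T. x j * (c j - y \<bullet> a j)) = \<eta>" using y by simp
      have slack: "c j - y \<bullet> a j \<le> \<eta> / x j" if "j \<in> T" for j
      proof -
        have "x j * (c j - y \<bullet> a j) \<le> \<eta>" unfolding s[symmetric]
          using that fT xpos le[OF y(1)] by (intro member_le_sum) (auto simp: less_imp_le)
        then show ?thesis using xpos[OF that] by (simp add: pos_le_divide_eq mult.commute)
      qed
      have "y \<bullet> a i - yT \<bullet> a i = (\<Sum>j\<in>T. \<rho> j * (y \<bullet> a j - c j))"
        unfolding \<rho>(2)[symmetric] inner_T[OF \<rho>(1)] by (simp add: right_diff_distrib sum_subtractf tT)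
      also have "\<dots> \<le> (\<Sum>j\<in>T. \<bar>\<rho> j\<bar> * (\<eta> / x j))"
      proof (intro sum_mono)
        fix j assume j: "j \<in> T"
        have "\<rho> j * (y \<bullet> a j - c j) \<le> \<bar>\<rho> j * (y \<bullet> a j - c j)\<bar>" by simp
        also have "\<dots> = \<bar>\<rho> j\<bar> * (c j - y \<bullet> a j)" using le[OF y(1) j] by (simp add: abs_mult)
        also have "\<dots> \<le> \<bar>\<rho> j\<bar> * (\<eta> / x j)" using slack[OF j] by (intro mult_left_mono) auto
        finally show "\<rho> j * (y \<bullet> a j - c j) \<le> \<bar>\<rho> j\<bar> * (\<eta> / x j)" .
      qed
      also have "\<dots> = \<eta> * M" by (simp add: M_def sum_distrib_left mult_ac)
      also have "\<dots> \<le> \<eta> * (M + 1)" using \<eta> by simp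
      also have "\<dots> < D" using \<eta> M by (simp add: pos_less_divide_eq)
      finally show ?thesis by (simp add: D_def)
    qed
    moreover have "0 < D / (M + 1)" using D M by simp
    ultimately show ?thesis unfolding eventually_at_right_field by blast
  qed
  then have "\<forall>\<^sub>F \<eta> in at_right 0. \<forall>i\<in>{..<n} - T. \<forall>y. feas c y \<longrightarrow> y \<bullet> a k = g - \<eta> \<longrightarrow> y \<bullet> a i < c i"
    by (intro eventually_ball_finite ballI) auto
  then obtain b where b: "0 < b" and near: "\<And>\<eta> i y. 0 < \<eta> \<Longrightarrow> \<eta> < b \<Longrightarrow> i < n \<Longrightarrow> i \<notin> T \<Longrightarrow> feas c y \<Longrightarrow>
      y \<bullet> a k = g - \<eta> \<Longrightarrow> y \<bullet> a i < c i"
    unfolding eventually_at_right_field by blast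
  \<comment> \<open>\<open>r < g\<close> removes \<open>T\<close> itself from the faces, and
    \<open>g - b < r\<close> ensures that a \<open>y\<close> tight at the new column has its other
    tight columns inside \<open>T\<close>.\<close>
  obtain r where r: "r \<in> \<rat>" "g - b < r" "r < g" using Rats_dense_in_real[of "g - b" g] b by auto
  define c' where "c' = c(k := r)"
  have feas': "feas c y \<and> y \<bullet> a k \<le> r" if "feas c' y" for y
    unfolding feas_def
  proof (intro conjI allI impI)
    show yk: "y \<bullet> a k \<le> r" using that k(1) by (auto simp: feas_def c'_def)
    fix j assume "j < n"
    then have "y \<bullet> a j \<le> c' j" using that by (simp add: feas_def)
    then show "y \<bullet> a j \<le> c j" using yk gk r by (cases "j = k") (auto simp: c'_def)
  qed
  have tight': "tight c' y = (if y \<bullet> a k = r then insert k (tight c y) else tight c y)" if "feas c' y" for y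
    using feas'[OF that] k(1) gk r by (auto simp: tight_def c'_def)
  have cases: "tight c' y = tight c y \<or> (\<exists>j\<in>T. tight c' y \<subseteq> insert k (T - {j}))" if y: "feas c' y" for y
  proof (cases "y \<bullet> a k = r")
    case True
    have "tight c y \<subseteq> T"
    proof
      fix i assume i: "i \<in> tight c y"
      show "i \<in> T"
      proof (rule ccontr)
        assume "i \<notin> T"
        then have "y \<bullet> a i < c i"
          using near[of "g - r" i y] r i feas'[OF y] True by (auto simp: tight_def)
        then show False using i by (simp add: tight_def)
      qed
    qed
    moreover have "\<not> T \<subseteq> tight c y"
    proof
      assume sub: "T \<subseteq> tight c y"
      have "y \<bullet> a k = g"
        unfolding gsum x(2)[symmetric] inner_T[OF sx]
        using sub by (intro sum.cong) (auto simp: tight_def)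
      then show False using True r by simp
    qed
    ultimately show ?thesis using tight'[OF y] True by auto
  qed (use tight'[OF y] in simp)
  have "generic c'"
    unfolding generic_def
  proof (intro allI impI)
    fix y assume y: "feas c' y"
    show "indep (tight c' y)" using cases[OF y]
    proof (elim disjE bexE)
      assume "tight c' y = tight c y"
      then show ?thesis using gen feas'[OF y] by (simp add: generic_def)
    next
      fix j assume j: "j \<in> T" "tight c' y \<subseteq> insert k (T - {j})"
      have "indep (insert k (T - {j}))"
        using xpos[OF j(1)] j(1) k(2) by (intro indep_star[OF T k(1) _ sx x(2)]) (auto simp: T_def)
      then show ?thesis using j(2) by (rule indep_mono)
    qed
  qed
  moreover have "c' j \<in> \<rat>" if "j < n" for j using rat[OF that] r by (simp add: c'_def)
  moreover have "feas c y \<and> y \<bullet> a k < yT \<bullet> a k" if "feas c' y" for y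
    using feas'[OF that] r by (auto simp: g_def)
  ultimately show thesis using cases unfolding T_def by (rule that)
qed

text \<open>Rewrite \<open>\<mu>\<close> in the coordinates \<open>p\<close> of \<open>T\<close>.
  Its fractional part \<open>s\<close> is a fractional point of \<open>T\<close>, so
  \<open>x e <= s e\<close> and \<open>s u + s v = 1\<close>. Minimality of \<open>x e\<close> rules
  out \<open>\<mu> e = 0\<close> and \<open>p e >= 1\<close>, the sum condition rules out
  \<open>p u >= 1\<close> and \<open>p v >= 1\<close>, so nothing is reduced and
  \<open>s = p\<close>.\<close>

lemma star_frac_pts:
  assumes T: "indep T" "T = {u, v, e}" "u \<noteq> v" "u \<noteq> e" "v \<noteq> e"
    and P: "\<And>s. s \<in> frac_pts T \<Longrightarrow> s u + s v = 1 \<and> 0 < s e \<and> (\<exists>j<n. comb s = a j)"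
    and x: "x \<in> frac_pts T" "\<And>s. s \<in> frac_pts T \<Longrightarrow> x e \<le> s e"
    and k: "k < n" "comb x = a k"
    and j: "j \<in> T" and \<mu>: "\<mu> \<in> frac_pts (insert k (T - {j}))"
  shows "j \<noteq> e \<and> comb \<mu> \<in> comb ` frac_pts T \<and> 0 < \<mu> e \<and> \<mu> k + \<mu> u + \<mu> v = 1"
proof -
  have kT: "k \<notin> T" using vertex_not_frac[OF T(1) x(1) k(2)] .
  have x01: "0 \<le> x i" "x i < 1" for i using x by (auto simp: frac_pts_def)
  have xuv: "x u + x v = 1" "0 < x e" using P[OF x(1)] by auto
  have "0 < x u" "0 < x v" using xuv x01[of u] x01[of v] by linarith+
  then have xpos: "0 < x i" if "i \<in> T" for i using that T(2) xuv by auto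
  have \<mu>01: "0 \<le> \<mu> i" "\<mu> i < 1" for i using \<mu> by (auto simp: frac_pts_def)
  have s\<mu>: "supp_in \<mu> (insert k (T - {j}))" and \<mu>L: "comb \<mu> \<in> L" using \<mu> by (auto simp: frac_pts_def)
  have \<mu>j: "\<mu> j = 0" using s\<mu> j kT by (auto simp: supp_in_def)
  define p where "p = subst_coord k x \<mu>"
  have p: "p i = \<mu> i + \<mu> k * x i" if "i \<in> T" for i using that kT by (auto simp: p_def subst_coord_def)
  have pe: "p u = \<mu> u + \<mu> k * x u" "p v = \<mu> v + \<mu> k * x v" "p e = \<mu> e + \<mu> k * x e"
    using p T(2) by auto
  have sp: "supp_in p T" unfolding p_def
    using x kT s\<mu> by (intro supp_subst_coord) (auto simp: frac_pts_def intro: supp_in_mono)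
  have cp: "comb p = comb \<mu>" unfolding p_def by (rule comb_subst_coord[OF k])
  \<comment> \<open>As \<open>\<mu> j = 0\<close>, integrality at \<open>j\<close> first forces
    \<open>\<mu> k = 0\<close>, and then every other coordinate vanishes.\<close>
  have "\<exists>i. p i \<notin> \<int>"
  proof (rule ccontr)
    assume "\<not> ?thesis"
    then have int: "p i \<in> \<int>" for i by blast
    have zero: "r = 0" if "r \<in> \<int>" "0 \<le> r" "r < 1" for r :: real
      using that by (elim Ints_cases) auto
    have "\<mu> k * x j = 0"
    proof (rule zero)
      show "\<mu> k * x j \<in> \<int>" using int[of j] p[OF j] \<mu>j by simp
      have "\<mu> k * x j \<le> 1 * x j" using \<mu>01[of k] x01[of j] by (intro mult_right_mono) auto
      then show "\<mu> k * x j < 1" using x01(2)[of j] by linarith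
    qed (use \<mu>01 x01 in simp)
    then have \<mu>k: "\<mu> k = 0" using xpos[OF j] by simp
    then have "\<mu> i = 0" for i
      using zero[of "\<mu> i"] int[of i] p[of i] \<mu>01[of i] s\<mu> \<mu>k
      by (cases "i \<in> T"; cases "i = k") (auto simp: supp_in_def)
    then show False using \<mu> by (auto simp: frac_pts_def)
  qed
  then obtain i where "p i \<notin> \<int>" by blast
  define s where "s = (\<lambda>i. frac (p i))"
  have s: "s \<in> frac_pts T" unfolding s_def using sp \<mu>L cp \<open>p i \<notin> \<int>\<close> by (intro frac_pts_frac) auto
  have se: "x e \<le> s e" "s u + s v = 1" using x(2)[OF s] P[OF s] by auto
  have fr: "s i = p i" if "p i < 1" "0 \<le> p i" for i using that by (simp add: s_def frac_eq)
  have fr1: "s i = p i - 1" if "1 \<le> p i" "p i < 2" for i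
    unfolding s_def using that by (simp add: frac_unique_iff)
  have p0: "0 \<le> p i" if "i \<in> T" for i using p[OF that] \<mu>01 x01 by simp
  have mul: "\<mu> k * x i \<le> x i" for i using \<mu>01[of k] x01[of i] by (simp add: mult_left_le_one_le)
  have mule: "\<mu> k * x e < x e" using \<mu>01[of k] xuv by simp
  have \<mu>e: "0 < \<mu> e"
  proof (rule ccontr)
    assume "\<not> 0 < \<mu> e"
    then have "p e < x e" using mule pe \<mu>01[of e] by simp
    then show False using fr[of e] se p0[of e] x01(2)[of e] T(2) by simp
  qed
  then have je: "j \<noteq> e" using \<mu>j by auto
  have "p e < 1"
  proof (rule ccontr)
    assume "\<not> p e < 1"
    moreover have "p e < 1 + x e" using pe mule \<mu>01(2)[of e] by linarith
    ultimately show False using fr1[of e] se x01(2)[of e] by simp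
  qed
  then have s_e: "s e = p e" using fr p0 T(2) by blast
  have sum: "p u + p v = \<mu> k + \<mu> u + \<mu> v"
  proof -
    have "p u + p v = \<mu> u + \<mu> v + \<mu> k * (x u + x v)" using pe by (simp add: algebra_simps)
    then show ?thesis using xuv by simp
  qed
  have j': "j = u \<or> j = v" using j T(2) je by auto
  have lt2: "p u + p v < 2" using sum j' \<mu>j \<mu>01(2)[of k] \<mu>01(2)[of u] \<mu>01(2)[of v] by auto
  have puv: "p u < 2" "p v < 2" using lt2 p0[of u] p0[of v] T(2) by auto
  have ltj: "p j < 1" using p[OF j] \<mu>j mul[of j] x01(2)[of j] by simp
  \<comment> \<open>At most one of the two can wrap around because \<open>p j < 1\<close>, and then
    the sum would drop below \<open>2 - 1\<close>, against \<open>s u + s v = 1\<close>.\<close>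
  have "p u < 1 \<and> p v < 1"
  proof (rule ccontr)
    assume "\<not> ?thesis"
    then have "s u + s v = p u + p v - 1"
      using j' ltj fr fr1[of u] fr1[of v] puv p0[of u] p0[of v] T(2) by (auto simp: not_less)
    then show False using se lt2 by simp
  qed
  then have s_uv: "s u = p u" "s v = p v" using fr p0 T(2) by auto
  have "s = p"
  proof
    fix i show "s i = p i"
    proof (cases "i \<in> T")
      case True then show ?thesis using s_e s_uv T(2) by auto
    next
      case False then show ?thesis using sp s by (auto simp: supp_in_def frac_pts_def)
    qed
  qed
  then have "comb \<mu> = comb s" using cp by simp
  then have "comb \<mu> \<in> comb ` frac_pts T" using s by (rule image_eqI)
  moreover have "\<mu> k + \<mu> u + \<mu> v = 1" using sum se s_uv by simp
  ultimately show ?thesis using je \<mu>e by blast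
qed

text \<open>The cardinality of this set is the termination measure. For a flat cost every fractional
  point is a column, so the set is empty only if the triangulation is unimodular.\<close>

definition pending :: "(nat \<Rightarrow> real) \<Rightarrow> nat set" where
  "pending c = {j. j < n \<and> (\<exists>y. feas c y \<and> a j \<in> comb ` frac_pts (tight c y))}"

definition flat_cost :: "(nat \<Rightarrow> real) \<Rightarrow> bool" where
  "flat_cost c \<longleftrightarrow> generic c \<and> (\<forall>j<n. c j \<in> \<rat>) \<and> (\<forall>y. feas c y \<longrightarrow> flat (tight c y))"

text \<open>Stellar subdivision at a fractional point that is lowest over the edge \<open>u v\<close>. The fractional
  points of the new cones are among those of \<open>T\<close>, and the subdivision point is not among them any more.\<close>
lemma flat_cost_star:
  assumes c: "flat_cost c" and y0: "feas c y0" "frac_pts (tight c y0) \<noteq> {}"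
  obtains c' where "flat_cost c'" "pending c' \<subset> pending c"
proof -
  define T where "T = tight c y0"
  have gen: "generic c" and rat: "\<And>j. j < n \<Longrightarrow> c j \<in> \<rat>" using c by (auto simp: flat_cost_def)
  have T: "indep T" using gen y0 by (simp add: generic_def T_def)
  have "flat T" using c y0 by (simp add: flat_cost_def T_def)
  then obtain u v e where uve: "T = {u, v, e}" "u \<noteq> v" "u \<noteq> e" "v \<noteq> e"
    and P: "\<And>s. s \<in> frac_pts T \<Longrightarrow> s u + s v = 1 \<and> 0 < s e \<and> (\<exists>j<n. comb s = a j)"
    using y0 unfolding flat_def T_def by blast
  obtain x where x: "x \<in> frac_pts T" "\<And>s. s \<in> frac_pts T \<Longrightarrow> x e \<le> s e"
    using frac_pts_minimal[OF T _ y0(2)[folded T_def], of e] P by blast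
  obtain k where k: "k < n" "comb x = a k" using P[OF x(1)] by blast
  have kT: "k \<notin> T" using vertex_not_frac[OF T x(1) k(2)] .
  have x01: "0 \<le> x i" "x i < 1" for i using x by (auto simp: frac_pts_def)
  have "x u + x v = 1" "0 < x e" using P[OF x(1)] by auto
  moreover from this have "0 < x u" "0 < x v" using x01[of u] x01[of v] by linarith+
  ultimately have xpos: "0 < x i" if "i \<in> T" for i using that uve(1) by auto
  have sx: "supp_in x T" using x by (simp add: frac_pts_def)
  have card: "card T = 3" using uve by simp
  obtain c' where gen': "generic c'" and rat': "\<And>j. j < n \<Longrightarrow> c' j \<in> \<rat>"
    and le': "\<And>y. feas c' y \<Longrightarrow> feas c y \<and> y \<bullet> a k < y0 \<bullet> a k"
    and tight': "\<And>y. feas c' y \<Longrightarrow> tight c' y = tight c y \<or> (\<exists>j\<in>T. tight c' y \<subseteq> insert k (T - {j}))"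
    using star[OF gen rat y0(1) card[unfolded T_def] k(1) kT[unfolded T_def] sx[unfolded T_def] k(2)
        xpos[unfolded T_def]] unfolding T_def by metis
  have pts: "j \<noteq> e \<and> comb \<mu> \<in> comb ` frac_pts T \<and> 0 < \<mu> e \<and> \<mu> k + \<mu> u + \<mu> v = 1"
    if "j \<in> T" "\<mu> \<in> frac_pts (insert k (T - {j}))" for j \<mu>
    by (rule star_frac_pts[of T u v e x k j \<mu>]) (fact T uve P x k that)+
  have flat': "flat (tight c' y)" if y: "feas c' y" for y using tight'[OF y]
  proof (elim disjE bexE)
    assume "tight c' y = tight c y"
    then show ?thesis using c le'[OF y] by (simp add: flat_cost_def)
  next
    fix j assume j: "j \<in> T" and sub: "tight c' y \<subseteq> insert k (T - {j})"
    show ?thesis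
    proof (cases "frac_pts (tight c' y) = {}")
      case False
      then obtain \<mu> where \<mu>: "\<mu> \<in> frac_pts (tight c' y)" by blast
      have pts': "j \<noteq> e \<and> comb \<mu> \<in> comb ` frac_pts T \<and> 0 < \<mu> e \<and> \<mu> k + \<mu> u + \<mu> v = 1"
        if "\<mu> \<in> frac_pts (tight c' y)" for \<mu>
        using pts[OF j] frac_pts_mono[OF sub] that by blast
      \<comment> \<open>The endpoint of the edge \<open>u v\<close> that survives the removal of
        \<open>j\<close>. In the new cone \<open>k w\<close> takes over the role of
        \<open>u v\<close>, and the opposite vertex is still \<open>e\<close>.\<close>
      define w where "w = (if j = u then v else u)"
      have w: "w \<in> T" "w \<noteq> e" "w \<noteq> k" "e \<noteq> k" "T - {j} = {w, e}"
        using uve kT j pts'[OF \<mu>] by (auto simp: w_def)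
      have sum: "\<mu> k + \<mu> w = 1" if "\<mu> \<in> frac_pts (tight c' y)" for \<mu>
      proof -
        have "\<mu> j = 0" using that sub j kT by (auto simp: frac_pts_def supp_in_def)
        then show ?thesis using pts'[OF that] j uve by (auto simp: w_def split: if_splits)
      qed
      have "\<mu> k < 1" "\<mu> w < 1" using \<mu> by (auto simp: frac_pts_def)
      then have "\<mu> k \<noteq> 0" "\<mu> w \<noteq> 0" "\<mu> e \<noteq> 0" using sum[OF \<mu>] pts'[OF \<mu>] by auto
      then have "{k, w, e} \<subseteq> tight c' y" using \<mu> by (auto simp: frac_pts_def supp_in_def)
      then have "tight c' y = {k, w, e}" using sub w by blast
      moreover have "\<forall>\<mu>\<in>frac_pts (tight c' y). \<mu> k + \<mu> w = 1 \<and> 0 < \<mu> e \<and> (\<exists>j<n. comb \<mu> = a j)"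
      proof
        fix \<mu> assume \<mu>: "\<mu> \<in> frac_pts (tight c' y)"
        obtain s where "s \<in> frac_pts T" "comb \<mu> = comb s" using pts'[OF \<mu>] by (metis imageE)
        then show "\<mu> k + \<mu> w = 1 \<and> 0 < \<mu> e \<and> (\<exists>j<n. comb \<mu> = a j)"
          using P[of s] sum[OF \<mu>] pts'[OF \<mu>] by simp
      qed
      moreover have "k \<noteq> w" "k \<noteq> e" "w \<noteq> e" using w by auto
      ultimately show ?thesis unfolding flat_def by metis
    qed (simp add: flat_def)
  qed
  have "pending c' \<subseteq> pending c"
  proof
    fix i assume "i \<in> pending c'"
    then obtain y where i: "i < n" and y: "feas c' y" "a i \<in> comb ` frac_pts (tight c' y)"
      by (auto simp: pending_def)
    obtain s where s: "s \<in> frac_pts (tight c' y)" "a i = comb s" using y(2) by (rule imageE)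
    have "a i \<in> comb ` frac_pts (tight c y) \<or> a i \<in> comb ` frac_pts (tight c y0)" using tight'[OF y(1)]
    proof (elim disjE bexE)
      assume "tight c' y = tight c y"
      then show ?thesis using y(2) by simp
    next
      fix j assume j: "j \<in> T" and "tight c' y \<subseteq> insert k (T - {j})"
      then have "s \<in> frac_pts (insert k (T - {j}))" using s(1) frac_pts_mono by blast
      from pts[OF j this] show ?thesis unfolding s(2) T_def by simp
    qed
    moreover have "feas c y" using le'[OF y(1)] by simp
    ultimately show "i \<in> pending c" unfolding pending_def using i y0(1) by blast
  qed
  moreover have "a k \<in> comb ` frac_pts (tight c y0)" using x(1) k(2) unfolding T_def by (metis imageI)
  then have "k \<in> pending c" unfolding pending_def using k(1) y0(1) by blast
  \<comment> \<open>Suppose \<open>a k\<close> is a fractional point \<open>s\<close> of a face of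
    \<open>y\<close>. A face inside a new cone would force \<open>s = x\<close>, whose support is
    all of \<open>T\<close>; so the face is old and \<open>y . a k\<close> equals the cost of
    \<open>s\<close> under \<open>c\<close>. That cost bounds \<open>y0 . a k\<close> from above,
    although lowering the cost of \<open>k\<close> gave \<open>y . a k < y0 . a k\<close>.\<close>
  moreover have "k \<notin> pending c'"
  proof
    assume "k \<in> pending c'"
    then obtain y s where y: "feas c' y" and s: "s \<in> frac_pts (tight c' y)" "comb s = a k"
      by (auto simp: pending_def)
    have "indep (tight c' y)" using gen' y by (simp add: generic_def)
    then have "k \<notin> tight c' y" using vertex_not_frac s by blast
    have "s j * c j \<le> s j * (y \<bullet> a j)" if "j < n" for j
    proof (cases "s j = 0")
      case False
      then have jt: "j \<in> tight c' y" using s by (auto simp: frac_pts_def supp_in_def)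
      show ?thesis using tight'[OF y]
      proof (elim disjE bexE)
        assume "tight c' y = tight c y"
        then show ?thesis using jt by (simp add: tight_def)
      next
        fix i assume i: "i \<in> T" "tight c' y \<subseteq> insert k (T - {i})"
        then have "tight c' y \<subseteq> T" using \<open>k \<notin> tight c' y\<close> by blast
        then have "s \<in> frac_pts T" using s frac_pts_mono by blast
        moreover have "s = x" using \<open>s \<in> frac_pts T\<close> x(1) s(2) k(2)
          by (intro indep_unique[OF T]) (auto simp: frac_pts_def)
        moreover have "i \<notin> tight c' y" using i kT by blast
        then have "s i = 0" using s by (auto simp: frac_pts_def supp_in_def)
        ultimately show ?thesis using xpos[OF i(1)] by simp
      qed
    qed simp
    then have "(\<Sum>j<n. s j * c j) \<le> y \<bullet> comb s" unfolding inner_comb by (intro sum_mono) auto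
    moreover have "y0 \<bullet> comb s \<le> (\<Sum>j<n. s j * c j)" unfolding inner_comb
      using y0(1) s(1) by (intro sum_mono mult_left_mono) (auto simp: feas_def frac_pts_def)
    ultimately show False using le'[OF y] s(2) by simp
  qed
  moreover have "flat_cost c'" using gen' rat' flat' by (simp add: flat_cost_def)
  ultimately show thesis using that by blast
qed

lemma unimodular_cost:
  obtains c where "generic c" "\<And>j. j < n \<Longrightarrow> c j \<in> \<rat>" "\<And>y. feas c y \<Longrightarrow> frac_pts (tight c y) = {}"
proof -
  have step: "\<exists>c'. flat_cost c' \<and> (\<forall>y. feas c' y \<longrightarrow> frac_pts (tight c' y) = {})" if "flat_cost c" for c
    using that
  proof (induction "card (pending c)" arbitrary: c rule: less_induct)
    case less
    show ?case
    proof (cases "\<forall>y. feas c y \<longrightarrow> frac_pts (tight c y) = {}")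
      case False
      then obtain c' where c': "flat_cost c'" "pending c' \<subset> pending c"
        using flat_cost_star[OF less.prems] by metis
      have "finite (pending c)" by (simp add: pending_def)
      then have "card (pending c') < card (pending c)" using c'(2) by (rule psubset_card_mono)
      then show ?thesis using less.hyps c'(1) by blast
    qed (use less.prems in blast)
  qed
  obtain c where gen: "generic c" and rat: "\<And>j. j < n \<Longrightarrow> c j \<in> \<rat>"
    and main: "\<And>y x. feas c y \<Longrightarrow> x \<in> frac_pts (tight c y) \<Longrightarrow>
       card (tight c y) = 3 \<and> (\<forall>j\<in>tight c y. 0 < x j) \<and> 1 < sz x \<and> sz x < 2 \<and> (\<exists>j<n. comb x = a j)"
    using hull_cost by metis
  have "flat (tight c y)" if y: "feas c y" for y
  proof (cases "frac_pts (tight c y) = {}")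
    case False
    then have "card (tight c y) = 3" using main[OF y] by blast
    then show ?thesis using gen y main[OF y]
      by (intro flat_of_heights) (auto simp: generic_def)
  qed (simp add: flat_def)
  then have "flat_cost c" using gen rat by (simp add: flat_cost_def)
  then show thesis using step that unfolding flat_cost_def by metis
qed

end

subsection \<open>Integral costs and faces\<close>

context column_config
begin

lemma feas_scale:
  assumes "0 < N"
  shows "feas (\<lambda>j. N * c j) y \<longleftrightarrow> feas c ((1 / N) *\<^sub>R y)"
    and "tight (\<lambda>j. N * c j) y = tight c ((1 / N) *\<^sub>R y)"
  using assms by (auto simp: feas_def tight_def field_simps)

lemma common_denominator:
  fixes c :: "nat \<Rightarrow> real"
  assumes "\<And>j. j < m \<Longrightarrow> c j \<in> \<rat>"
  shows "\<exists>N::nat. 0 < N \<and> (\<forall>j<m. real N * c j \<in> \<int>)"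
  using assms
proof (induction m)
  case (Suc m)
  then obtain N :: nat where N: "0 < N" "\<And>j. j < m \<Longrightarrow> real N * c j \<in> \<int>" by auto
  obtain p q where q: "q \<noteq> 0" "c m = real_of_int p / real q"
    using Suc.prems[of m] by (auto simp: Rats_eq_int_div_nat)
  have "real (N * q) * c j \<in> \<int>" if "j < Suc m" for j
  proof (cases "j = m")
    case True
    then have "real (N * q) * c j = real_of_int (int N * p)" using q by simp
    then show ?thesis by (metis Ints_of_int)
  next
    case False
    then have "real (N * q) * c j = real q * (real N * c j)" by simp
    moreover have "real q * (real N * c j) \<in> \<int>"
      using that False by (intro Ints_mult[OF Ints_of_nat N(2)]) simp
    ultimately show ?thesis by (simp only:)
  qed
  then show ?case using N q by (intro exI[of _ "N * q"]) auto
qed (auto intro: exI[of _ 1])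

text \<open>Clearing denominators only dilates the dual polyhedron, so the family of tight sets
  stays the same.\<close>

lemma unimodular_int_cost:
  obtains c :: "nat \<Rightarrow> int" where "generic (\<lambda>j. real_of_int (c j))"
    "\<And>y. feas (\<lambda>j. real_of_int (c j)) y \<Longrightarrow> frac_pts (tight (\<lambda>j. real_of_int (c j)) y) = {}"
proof -
  obtain c where c: "generic c" "\<And>j. j < n \<Longrightarrow> c j \<in> \<rat>" "\<And>y. feas c y \<Longrightarrow> frac_pts (tight c y) = {}"
    using unimodular_cost by metis
  obtain N :: nat where N: "0 < N" "\<And>j. j < n \<Longrightarrow> real N * c j \<in> \<int>"
    using common_denominator[of n c] c(2) by blast
  define d where "d = (\<lambda>j. \<lfloor>real N * c j\<rfloor>)"
  have d: "real_of_int (d j) = real N * c j" if "j < n" for j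
    using N(2)[OF that] unfolding d_def by (elim Ints_cases) simp
  have eq: "feas (\<lambda>j. real_of_int (d j)) y \<longleftrightarrow> feas c ((1 / real N) *\<^sub>R y)"
    "tight (\<lambda>j. real_of_int (d j)) y = tight c ((1 / real N) *\<^sub>R y)" for y
    using feas_scale[of "real N" c y] N(1) d by (auto simp: feas_def tight_def)
  show thesis
  proof (rule that[of d])
    show "generic (\<lambda>j. real_of_int (d j))" using c(1) unfolding generic_def eq by blast
    show "frac_pts (tight (\<lambda>j. real_of_int (d j)) y) = {}" if "feas (\<lambda>j. real_of_int (d j)) y" for y
      using that unfolding eq by (rule c(3))
  qed
qed

text \<open>Independence of the tight columns provides a direction that is 0 on
  \<open>\<tau>\<close> and negative on the rest of the face; a short step along it releases exactly
  that rest.\<close>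

lemma face_subset:
  assumes gen: "generic c" and y: "feas c y" and \<tau>: "\<tau> \<subseteq> tight c y"
  obtains y' where "feas c y'" "tight c y' = \<tau>"
proof -
  define \<sigma> where "\<sigma> = tight c y"
  have \<sigma>: "indep \<sigma>" using gen y by (simp add: generic_def \<sigma>_def)
  define f where "f = (\<lambda>v. if inv_into \<sigma> a v \<in> \<tau> then 0 else - 1 :: real)"
  obtain g where g: "linear g" "\<forall>v\<in>a ` \<sigma>. g v = f v"
    using linear_independent_extend[OF indep_independent[OF \<sigma>], of f] by blast
  \<comment> \<open>The vector that represents the functional \<open>g\<close> by the inner
    product.\<close>
  define w where "w = adjoint g 1"
  have w: "w \<bullet> a j = (if j \<in> \<tau> then 0 else - 1)" if "j \<in> \<sigma>" for j
  proof -
    have "w \<bullet> a j = g (a j)" unfolding w_def using adjoint_works[OF g(1), of "a j" 1]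
      by (simp add: inner_commute)
    also have "\<dots> = f (a j)" using g(2) that by blast
    finally show ?thesis using inv_into_f_f[OF indep_inj[OF \<sigma>] that] by (simp add: f_def)
  qed
  have "\<forall>\<^sub>F \<eta> in at_right 0. \<forall>j\<in>{..<n} - \<sigma>. (y + \<eta> *\<^sub>R w) \<bullet> a j < c j"
  proof (intro eventually_ball_finite ballI)
    fix j assume j: "j \<in> {..<n} - \<sigma>"
    have "((\<lambda>\<eta>. (y + \<eta> *\<^sub>R w) \<bullet> a j) \<longlongrightarrow> (y + 0 *\<^sub>R w) \<bullet> a j) (at_right 0)" by (intro tendsto_intros)
    moreover have "(y + 0 *\<^sub>R w) \<bullet> a j < c j" using y j by (auto simp: feas_def \<sigma>_def tight_def less_le)
    ultimately show "\<forall>\<^sub>F \<eta> in at_right 0. (y + \<eta> *\<^sub>R w) \<bullet> a j < c j" by (rule order_tendstoD)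
  qed simp
  then obtain b where b: "0 < b" "\<And>\<eta>. 0 < \<eta> \<Longrightarrow> \<eta> < b \<Longrightarrow> \<forall>j\<in>{..<n} - \<sigma>. (y + \<eta> *\<^sub>R w) \<bullet> a j < c j"
    unfolding eventually_at_right_field by blast
  define y' where "y' = y + (b / 2) *\<^sub>R w"
  have out: "y' \<bullet> a j < c j" if "j < n" "j \<notin> \<sigma>" for j
    using b(2)[of "b / 2"] b(1) that by (auto simp: y'_def)
  have inn: "y' \<bullet> a j = (if j \<in> \<tau> then c j else c j - b / 2)" if "j \<in> \<sigma>" for j
    using w[OF that] that by (auto simp: y'_def inner_add_left \<sigma>_def tight_def)
  have "feas c y'"
    unfolding feas_def
  proof (intro allI impI)
    fix j assume "j < n"
    then show "y' \<bullet> a j \<le> c j" using out[of j] inn[of j] b(1) by (cases "j \<in> \<sigma>") auto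
  qed
  moreover have "tight c y' = \<tau>"
  proof (intro set_eqI iffI)
    fix j assume j: "j \<in> tight c y'"
    then have "j \<in> \<sigma>" using out[of j] by (force simp: tight_def)
    then show "j \<in> \<tau>" using inn[of j] j b(1) by (auto simp: tight_def split: if_splits)
  next
    fix j assume j: "j \<in> \<tau>"
    then show "j \<in> tight c y'" using inn[of j] \<tau> by (auto simp: tight_def \<sigma>_def)
  qed
  ultimately show thesis by (rule that)
qed

text \<open>The ratio test: move from \<open>y\<close> along a direction orthogonal to the face
  until the first further column becomes tight.\<close>

lemma face_extend:
  assumes y: "feas c y" and w: "\<And>j. j \<in> tight c y \<Longrightarrow> w \<bullet> a j = 0" and k: "k < n" "w \<bullet> a k \<noteq> 0"
  obtains y' where "feas c y'" "tight c y \<subset> tight c y'"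
proof -
  define w' where "w' = (if 0 < w \<bullet> a k then w else - w)"
  have w': "\<And>j. j \<in> tight c y \<Longrightarrow> w' \<bullet> a j = 0" "0 < w' \<bullet> a k" using w k by (auto simp: w'_def)
  define S where "S = {j. j < n \<and> 0 < w' \<bullet> a j}"
  define h where "h = (\<lambda>j. (c j - y \<bullet> a j) / (w' \<bullet> a j))"
  have S: "finite S" "k \<in> S" using k w' by (auto simp: S_def)
  define i where "i = arg_min_on h S"
  have iS: "i \<in> S" unfolding i_def using S by (intro arg_min_if_finite) auto
  have hi: "h i \<le> h j" if "j \<in> S" for j unfolding i_def using S that by (intro arg_min_least) auto
  define y' where "y' = y + h i *\<^sub>R w'"
  have h0: "0 \<le> h i" using iS y by (auto simp: h_def S_def feas_def)
  have "feas c y'"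
    unfolding feas_def
  proof (intro allI impI)
    fix j assume j: "j < n"
    show "y' \<bullet> a j \<le> c j"
    proof (cases "0 < w' \<bullet> a j")
      case True
      then have "h i \<le> h j" using j by (intro hi) (simp add: S_def)
      then have "h i * (w' \<bullet> a j) \<le> c j - y \<bullet> a j" using True by (simp add: h_def pos_le_divide_eq)
      then show ?thesis by (simp add: y'_def inner_add_left)
    next
      case False
      then have "h i * (w' \<bullet> a j) \<le> 0" using h0 by (simp add: mult_nonneg_nonpos)
      moreover have "y \<bullet> a j \<le> c j" using y j by (simp add: feas_def)
      ultimately show ?thesis by (simp add: y'_def inner_add_left)
    qed
  qed
  moreover have "tight c y \<subseteq> tight c y'" using w'(1) by (auto simp: tight_def y'_def inner_add_left)
  moreover have "i \<in> tight c y'" using iS by (auto simp: tight_def y'_def inner_add_left h_def S_def)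
  moreover have "i \<notin> tight c y" using w'(1)[of i] iS by (auto simp: S_def)
  ultimately show thesis using that by blast
qed

text \<open>Both dual solutions attain the same optimal value at the common point, so
  \<open>x'\<close> satisfies complementary slackness with \<open>y\<close> as well.\<close>

lemma cone_Int:
  assumes y: "feas c y" "feas c y'" and x: "supp_in x (tight c y)" "\<And>j. 0 \<le> x j"
    and x': "supp_in x' (tight c y')" "\<And>j. 0 \<le> x' j" and eq: "comb x = comb x'"
  shows "supp_in x' (tight c y \<inter> tight c y')"
proof -
  have val: "z \<bullet> comb s = (\<Sum>j<n. s j * c j)" if "supp_in s (tight c z)" for z s
    unfolding inner_comb using that by (intro sum.cong) (auto simp: supp_in_def tight_def)
  have le: "z \<bullet> comb s \<le> (\<Sum>j<n. s j * c j)" if "feas c z" "\<And>j. 0 \<le> s j" for z s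
    unfolding inner_comb using that by (intro sum_mono mult_left_mono) (auto simp: feas_def)
  have "(\<Sum>j<n. x' j * c j) \<le> y \<bullet> comb x'"
    using val[OF x'(1)] le[of y' x, OF y(2) x(2)] val[OF x(1)] eq by simp
  then have "(\<Sum>j<n. x' j * (c j - y \<bullet> a j)) \<le> 0"
    by (simp add: inner_comb right_diff_distrib sum_subtractf)
  moreover have nn: "0 \<le> x' j * (c j - y \<bullet> a j)" if "j < n" for j
    using x'(2)[of j] y(1) that by (simp add: feas_def)
  ultimately have "(\<Sum>j<n. x' j * (c j - y \<bullet> a j)) = 0" by (intro antisym sum_nonneg) auto
  moreover have "(\<Sum>j<n. x' j * (c j - y \<bullet> a j)) = 0 \<longleftrightarrow> (\<forall>j\<in>{..<n}. x' j * (c j - y \<bullet> a j) = 0)"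
    using nn by (intro sum_nonneg_eq_0_iff) auto
  ultimately have "\<forall>j\<in>{..<n}. x' j * (c j - y \<bullet> a j) = 0" by blast
  then show ?thesis using x'(1) by (fastforce simp: supp_in_def tight_def)
qed

end

text \<open>The dimension \<open>d\<close> is not a type, so \<open>\<real>\<^sup>d\<close> is embedded into \<open>\<real>\<^sup>3\<close>.\<close>
definition emb :: "nat \<Rightarrow> (nat \<Rightarrow> real) \<Rightarrow> real ^ 3" where
  "emb d y = vector [if 0 < d then y 0 else 0, if 1 < d then y 1 else 0, if 2 < d then y 2 else 0]"

definition unemb :: "real ^ 3 \<Rightarrow> nat \<Rightarrow> real" where
  "unemb v i = (if i = 0 then v $ 1 else if i = 1 then v $ 2 else v $ 3)"

lemma inner_emb:
  assumes "d \<le> 3"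
  shows "v \<bullet> emb d y = (\<Sum>i<d. unemb v i * y i)"
proof -
  have "d = 0 \<or> d = 1 \<or> d = 2 \<or> d = 3" using assms by linarith
  then show ?thesis
    by (elim disjE) (simp_all add: inner_vec_def sum_3 emb_def unemb_def numeral_3_eq_3 numeral_2_eq_2)
qed

lemma unemb_emb: "d \<le> 3 \<Longrightarrow> i < d \<Longrightarrow> unemb (emb d y) i = y i"
  by (cases "i = 0"; cases "i = 1"; cases "i = 2") (auto simp: unemb_def emb_def)

lemma emb_cong: "(\<And>i. i < d \<Longrightarrow> y i = z i) \<Longrightarrow> emb d y = emb d z"
  by (simp add: emb_def)

lemma emb_eq_iff: "d \<le> 3 \<Longrightarrow> emb d y = emb d z \<longleftrightarrow> (\<forall>i<d. y i = z i)"
  by (metis emb_cong unemb_emb)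

lemma emb_simps:
  "emb d (\<lambda>i. 0) = 0" "emb d (\<lambda>i. y i + z i) = emb d y + emb d z"
  "emb d (\<lambda>i. y i - z i) = emb d y - emb d z" "emb d (\<lambda>i. r * y i) = r *\<^sub>R emb d y"
  by (simp_all add: emb_def vec_eq_iff forall_3)

lemma emb_sum: "emb d (\<lambda>i. \<Sum>j\<in>J. f i j) = (\<Sum>j\<in>J. emb d (\<lambda>i. f i j))"
  by (induction J rule: infinite_finite_induct) (simp_all add: emb_simps)

section \<open>The matrix as a column configuration in \<open>real ^ 3\<close>\<close>

locale normal_matrix =
  fixes A :: "nat \<Rightarrow> nat \<Rightarrow> int" and d n :: nat
  assumes rank: "full_row_rank A d n"
    and trivial_kernel: "\<forall>x :: nat \<Rightarrow> real. (\<forall>j<n. 0 \<le> x j) \<and> (\<forall>i<d. (\<Sum>j<n. real_of_int (A i j) * x j) = 0)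
                   \<longrightarrow> (\<forall>j<n. x j = 0)"
    and normal_A: "normal_config A d n"
    and d3: "d \<le> 3"
begin

definition col :: "nat \<Rightarrow> real ^ 3" where
  "col j = emb d (\<lambda>i. real_of_int (A i j))"

definition lat :: "(real ^ 3) set" where
  "lat = range (\<lambda>b :: nat \<Rightarrow> int. emb d (\<lambda>i. real_of_int (b i)))"

lemma sum_col: "(\<Sum>j\<in>J. x j *\<^sub>R col j) = emb d (\<lambda>i. \<Sum>j\<in>J. real_of_int (A i j) * x j)"
  unfolding emb_sum col_def by (simp add: emb_simps(4)[symmetric] mult.commute)

sublocale column_config col n lat
proof
  show "DIM(real ^ 3) \<le> 3" by simp
  show "0 \<in> lat" unfolding lat_def by (rule range_eqI[of _ _ "\<lambda>i. 0"]) (simp add: emb_simps)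
  show "v - w \<in> lat" if "v \<in> lat" "w \<in> lat" for v w
  proof -
    obtain b where "v = emb d (\<lambda>i. real_of_int (b i))" using \<open>v \<in> lat\<close> unfolding lat_def by (rule rangeE)
    moreover obtain b' where "w = emb d (\<lambda>i. real_of_int (b' i))"
      using \<open>w \<in> lat\<close> unfolding lat_def by (rule rangeE)
    ultimately have "v - w = emb d (\<lambda>i. real_of_int (b i - b' i))" by (simp add: emb_simps)
    then show ?thesis unfolding lat_def by (rule range_eqI[of _ _ "\<lambda>i. b i - b' i"])
  qed
  show "col j \<in> lat" for j unfolding lat_def col_def by (rule range_eqI[of _ _ "\<lambda>i. A i j"]) simp
  show "\<exists>u :: nat \<Rightarrow> nat. (\<Sum>j<n. x j *\<^sub>R col j) = (\<Sum>j<n. real (u j) *\<^sub>R col j)"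
    if x: "\<forall>j<n. 0 \<le> x j" "(\<Sum>j<n. x j *\<^sub>R col j) \<in> lat" for x
  proof -
    obtain b where b: "(\<Sum>j<n. x j *\<^sub>R col j) = emb d (\<lambda>i. real_of_int (b i))"
      using x(2) unfolding lat_def by blast
    then have "\<forall>i<d. (\<Sum>j<n. real_of_int (A i j) * x j) = real_of_int (b i)"
      unfolding sum_col emb_eq_iff[OF d3] .
    then have "\<forall>i<d. matvec_real A d {..<n} x i = real_of_int (b i)" by (simp add: matvec_real_def)
    moreover have "matvec_real A d {..<n} x \<in> cone_of A d {..<n}" unfolding cone_of_def using x(1) by auto
    ultimately have "in_NA A d n b" using normal_A unfolding normal_config_def by blast
    then obtain u where u: "\<And>i. i < d \<Longrightarrow> (\<Sum>j<n. A i j * int (u j)) = b i" unfolding in_NA_def by blast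
    have "emb d (\<lambda>i. real_of_int (b i)) = (\<Sum>j<n. real (u j) *\<^sub>R col j)"
      unfolding sum_col by (rule emb_cong) (simp add: u[symmetric])
    with b have "(\<Sum>j<n. x j *\<^sub>R col j) = (\<Sum>j<n. real (u j) *\<^sub>R col j)" by (rule trans)
    then show ?thesis by blast
  qed
  show "\<forall>j<n. x j = 0" if x: "\<forall>j<n. 0 \<le> x j" "(\<Sum>j<n. x j *\<^sub>R col j) = 0" for x
  proof -
    have "emb d (\<lambda>i. \<Sum>j<n. real_of_int (A i j) * x j) = emb d (\<lambda>i. 0)"
      using x(2) unfolding sum_col by (simp add: emb_simps)
    then have "\<forall>i<d. (\<Sum>j<n. real_of_int (A i j) * x j) = 0" unfolding emb_eq_iff[OF d3] .
    then show ?thesis using trivial_kernel x(1) by blast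
  qed
  show "col j \<bullet> col j \<in> \<rat>" for j
  proof -
    have "col j \<bullet> col j = (\<Sum>i<d. real_of_int (A i j) * real_of_int (A i j))"
      using inner_emb[OF d3, of "col j" "\<lambda>i. real_of_int (A i j)"] unemb_emb[OF d3] by (simp add: col_def)
    also have "\<dots> = real_of_int (\<Sum>i<d. A i j * A i j)" by simp
    finally show ?thesis by (metis Rats_of_int)
  qed
qed

lemma comb_col: "comb x = emb d (\<lambda>i. \<Sum>j<n. real_of_int (A i j) * x j)"
  unfolding comb_def by (rule sum_col)

lemma inner_col: "v \<bullet> col j = colprod A d (unemb v) j"
  unfolding col_def colprod_def by (rule inner_emb[OF d3])

lemma colprod_eq: "colprod A d y j = emb d y \<bullet> col j"
  unfolding inner_col colprod_def by (simp add: unemb_emb[OF d3])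

lemma Delta_iff: "\<sigma> \<in> Delta A d n c \<longleftrightarrow> (\<exists>v. feas c v \<and> tight c v = \<sigma>)"
proof
  assume "\<sigma> \<in> Delta A d n c"
  then obtain y where sub: "\<sigma> \<subseteq> {..<n}"
    and y: "\<And>j. j < n \<Longrightarrow> (j \<in> \<sigma> \<longrightarrow> colprod A d y j = c j) \<and> (j \<notin> \<sigma> \<longrightarrow> colprod A d y j < c j)"
    unfolding Delta_def by blast
  have "feas c (emb d y)" unfolding feas_def colprod_eq[symmetric] using y by (metis less_le_not_le order_refl)
  moreover have "tight c (emb d y) = \<sigma>"
    unfolding tight_def colprod_eq[symmetric] using y sub by (force simp: less_le)
  ultimately show "\<exists>v. feas c v \<and> tight c v = \<sigma>" by blast
next
  assume "\<exists>v. feas c v \<and> tight c v = \<sigma>"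
  then obtain v where v: "feas c v" "tight c v = \<sigma>" by blast
  have "(j \<in> \<sigma> \<longrightarrow> colprod A d (unemb v) j = c j) \<and> (j \<notin> \<sigma> \<longrightarrow> colprod A d (unemb v) j < c j)" if "j < n" for j
    using v that unfolding inner_col[symmetric] by (auto simp: feas_def tight_def less_le)
  moreover have "\<sigma> \<subseteq> {..<n}" using v by (auto simp: tight_def)
  ultimately show "\<sigma> \<in> Delta A d n c" unfolding Delta_def by blast
qed

lemma matvec_supp:
  assumes "supp_in x \<sigma>" "\<sigma> \<subseteq> {..<n}"
  shows "matvec_real A d \<sigma> x = matvec_real A d {..<n} x"
  unfolding matvec_real_def using assms
  by (intro ext if_cong refl sum.mono_neutral_left) (auto simp: supp_in_def)

lemma cone_of_iff:
  assumes "\<sigma> \<subseteq> {..<n}"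
  shows "v \<in> cone_of A d \<sigma> \<longleftrightarrow> (\<exists>x. supp_in x \<sigma> \<and> (\<forall>j. 0 \<le> x j) \<and> v = matvec_real A d {..<n} x)"
proof
  assume "v \<in> cone_of A d \<sigma>"
  then obtain x where x: "\<forall>j\<in>\<sigma>. 0 \<le> x j" "v = matvec_real A d \<sigma> x" unfolding cone_of_def by blast
  define x' where "x' = (\<lambda>j. if j \<in> \<sigma> then x j else 0)"
  have s: "supp_in x' \<sigma>" "\<forall>j. 0 \<le> x' j" using x(1) by (auto simp: x'_def supp_in_def)
  have "matvec_real A d \<sigma> x = matvec_real A d \<sigma> x'"
    unfolding matvec_real_def by (intro ext if_cong refl sum.cong) (auto simp: x'_def)
  then show "\<exists>x. supp_in x \<sigma> \<and> (\<forall>j. 0 \<le> x j) \<and> v = matvec_real A d {..<n} x"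
    using s x(2) matvec_supp[OF s(1) assms] by auto
next
  assume "\<exists>x. supp_in x \<sigma> \<and> (\<forall>j. 0 \<le> x j) \<and> v = matvec_real A d {..<n} x"
  then obtain x where x: "supp_in x \<sigma>" "\<forall>j. 0 \<le> x j" "v = matvec_real A d {..<n} x" by blast
  then have "v = matvec_real A d \<sigma> x" using matvec_supp[OF x(1) assms] by simp
  moreover have "\<forall>j\<in>\<sigma>. 0 \<le> x j" using x(2) by simp
  ultimately show "v \<in> cone_of A d \<sigma>" unfolding cone_of_def by (intro CollectI exI[of _ x] conjI)
qed

lemma matvec_eq_iff: "matvec_real A d {..<n} x = matvec_real A d {..<n} x' \<longleftrightarrow> comb x = comb x'"
  unfolding comb_col emb_eq_iff[OF d3] matvec_real_def by (auto simp: fun_eq_iff)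

text \<open>Subfaces come from \<open>face_subset\<close>, intersections from
  \<open>cone_Int\<close>, and the covering of the whole cone from \<open>lp_dual\<close>.\<close>

lemma generic_triangulation:
  assumes gen: "generic c"
  shows "is_triangulation A d n (Delta A d n c)"
  unfolding is_triangulation_def
proof (intro conjI ballI allI impI)
  fix \<sigma> assume "\<sigma> \<in> Delta A d n c"
  then obtain y where y: "feas c y" "tight c y = \<sigma>" unfolding Delta_iff by blast
  have \<sigma>: "indep \<sigma>" using gen y by (auto simp: generic_def)
  show sub: "\<sigma> \<subseteq> {..<n}" by (rule indep_subset[OF \<sigma>])
  show "lin_indep_cols A d \<sigma>"
    unfolding lin_indep_cols_def
  proof (intro allI impI ballI)
    fix x j assume x: "\<forall>i<d. (\<Sum>j\<in>\<sigma>. real_of_int (A i j) * x j) = 0" and j: "j \<in> \<sigma>"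
    define x' where "x' = (\<lambda>j. if j \<in> \<sigma> then x j else 0)"
    have s: "supp_in x' \<sigma>" by (auto simp: x'_def supp_in_def)
    have "comb x' = (\<Sum>j\<in>\<sigma>. x j *\<^sub>R col j)"
      unfolding comb_supp[OF s sub] by (intro sum.cong) (auto simp: x'_def)
    also have "\<dots> = emb d (\<lambda>i. 0)" unfolding sum_col using x by (intro emb_cong) auto
    finally have "comb x' = 0" by (simp add: emb_simps)
    then have "x' j = 0" using \<sigma> s unfolding indep_def by blast
    then show "x j = 0" using j by (simp add: x'_def)
  qed
  fix \<tau> assume "\<tau> \<subseteq> \<sigma>"
  then obtain y' where "feas c y'" "tight c y' = \<tau>" using face_subset[OF gen y(1), of \<tau>] y(2) by metis
  then show "\<tau> \<in> Delta A d n c" unfolding Delta_iff by blast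
next
  fix \<sigma> \<tau> assume "\<sigma> \<in> Delta A d n c" "\<tau> \<in> Delta A d n c"
  then obtain y y' where y: "feas c y" "tight c y = \<sigma>" "feas c y'" "tight c y' = \<tau>" unfolding Delta_iff by blast
  have sub: "\<sigma> \<subseteq> {..<n}" "\<tau> \<subseteq> {..<n}" "\<sigma> \<inter> \<tau> \<subseteq> {..<n}" using y by (auto simp: tight_def)
  show "cone_of A d \<sigma> \<inter> cone_of A d \<tau> = cone_of A d (\<sigma> \<inter> \<tau>)"
  proof (intro set_eqI iffI)
    fix v assume "v \<in> cone_of A d \<sigma> \<inter> cone_of A d \<tau>"
    then obtain x x' where x: "supp_in x \<sigma>" "\<forall>j. 0 \<le> x j" "v = matvec_real A d {..<n} x"
      "supp_in x' \<tau>" "\<forall>j. 0 \<le> x' j" "v = matvec_real A d {..<n} x'"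
      using sub by (auto simp: cone_of_iff)
    then have "comb x = comb x'" using matvec_eq_iff by metis
    then have "supp_in x' (\<sigma> \<inter> \<tau>)" using cone_Int[OF y(1,3)] x y by simp
    then show "v \<in> cone_of A d (\<sigma> \<inter> \<tau>)" using x sub by (auto simp: cone_of_iff)
  next
    fix v assume "v \<in> cone_of A d (\<sigma> \<inter> \<tau>)"
    then obtain x where x: "supp_in x (\<sigma> \<inter> \<tau>)" "\<forall>j. 0 \<le> x j" "v = matvec_real A d {..<n} x"
      using cone_of_iff[OF sub(3)] by blast
    have "supp_in x \<sigma>" "supp_in x \<tau>" using supp_in_mono[OF x(1)] by auto
    then show "v \<in> cone_of A d \<sigma> \<inter> cone_of A d \<tau>"
      using x(2,3) cone_of_iff[OF sub(1)] cone_of_iff[OF sub(2)] by blast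
  qed
next
  show "(\<Union>\<sigma>\<in>Delta A d n c. cone_of A d \<sigma>) = cone_of A d {..<n}"
  proof (intro set_eqI iffI)
    fix v assume "v \<in> (\<Union>\<sigma>\<in>Delta A d n c. cone_of A d \<sigma>)"
    then obtain \<sigma> where \<sigma>: "\<sigma> \<in> Delta A d n c" "v \<in> cone_of A d \<sigma>" by blast
    have sub: "\<sigma> \<subseteq> {..<n}" using \<sigma>(1) by (simp add: Delta_def)
    obtain x where x: "supp_in x \<sigma>" "\<forall>j. 0 \<le> x j" "v = matvec_real A d {..<n} x"
      using \<sigma>(2) unfolding cone_of_iff[OF sub] by blast
    have "supp_in x {..<n}" using supp_in_mono[OF x(1) sub] .
    then show "v \<in> cone_of A d {..<n}" unfolding cone_of_iff[OF subset_refl] using x by blast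
  next
    fix v assume "v \<in> cone_of A d {..<n}"
    then obtain x0 where x0: "\<forall>j. 0 \<le> x0 j" "v = matvec_real A d {..<n} x0"
      unfolding cone_of_iff[OF subset_refl] by blast
    obtain y x where y: "feas c y" and x: "supp_in x (tight c y)" "\<And>j. 0 \<le> x j" "comb x = comb x0"
      using lp_dual[of x0 c] x0(1) by metis
    have sub: "tight c y \<subseteq> {..<n}" by (auto simp: tight_def)
    have "v = matvec_real A d {..<n} x" using x0(2) x(3) matvec_eq_iff by simp
    then have "v \<in> cone_of A d (tight c y)" unfolding cone_of_iff[OF sub] using x by blast
    moreover have "tight c y \<in> Delta A d n c" unfolding Delta_iff using y by blast
    ultimately show "v \<in> (\<Union>\<sigma>\<in>Delta A d n c. cone_of A d \<sigma>)" by blast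
  qed
qed

section \<open>Integer programs and group relaxations over a unimodular triangulation\<close>

lemma ip_feasible_comb:
  assumes "ip_feasible A d n b u"
  shows "comb (\<lambda>j. real (u j)) = emb d (\<lambda>i. real_of_int (b i))"
  unfolding comb_col
proof (rule emb_cong)
  fix i assume "i < d"
  then have "(\<Sum>j<n. A i j * int (u j)) = b i" using assms by (simp add: ip_feasible_def)
  then show "(\<Sum>j<n. real_of_int (A i j) * real (u j)) = real_of_int (b i)" by (simp add: \<open>_ = b i\<close>[symmetric])
qed

text \<open>A non-integral coordinate of the linear optimum from \<open>lp_dual\<close> would leave
  a fractional point of its face.\<close>

lemma integral_solution:
  assumes uni: "\<And>y. feas c y \<Longrightarrow> frac_pts (tight c y) = {}" and b: "in_NA A d n b"
  obtains y u where "feas c y" "\<And>j. j \<notin> tight c y \<Longrightarrow> u j = 0" "ip_feasible A d n b u"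
proof -
  obtain u0 where u0: "\<And>i. i < d \<Longrightarrow> (\<Sum>j<n. A i j * int (u0 j)) = b i" using b unfolding in_NA_def by blast
  have cu0: "comb (\<lambda>j. real (u0 j)) = emb d (\<lambda>i. real_of_int (b i))"
    unfolding comb_col by (rule emb_cong) (simp add: u0[symmetric])
  obtain y x where y: "feas c y" and x: "supp_in x (tight c y)" "\<And>j. 0 \<le> x j" "comb x = comb (\<lambda>j. real (u0 j))"
    using lp_dual[of "\<lambda>j. real (u0 j)" c] by auto
  have xb: "comb x = emb d (\<lambda>i. real_of_int (b i))" using x(3) cu0 by simp
  have "comb x \<in> lat" unfolding xb lat_def by blast
  then have int: "x j \<in> \<int>" for j using frac_pts_frac[OF x(1), of j] uni[OF y] by blast
  define u where "u = (\<lambda>j. nat \<lfloor>x j\<rfloor>)"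
  have u: "real (u j) = x j" for j
    using int[of j] x(2)[of j] unfolding u_def by (elim Ints_cases) auto
  have z: "u j = 0" if "j \<notin> tight c y" for j
  proof -
    have "x j = 0" using x(1) that by (simp add: supp_in_def)
    then show ?thesis by (simp add: u_def)
  qed
  have "ip_feasible A d n b u"
    unfolding ip_feasible_def
  proof (intro conjI allI impI)
    show "u j = 0" if "n \<le> j" for j using that by (intro z) (simp add: tight_def)
    fix i assume i: "i < d"
    have "(\<Sum>j<n. real_of_int (A i j) * x j) = real_of_int (b i)"
      using xb i unfolding comb_col emb_eq_iff[OF d3] by blast
    then have "real_of_int (\<Sum>j<n. A i j * int (u j)) = real_of_int (b i)" by (simp add: u)
    then show "(\<Sum>j<n. A i j * int (u j)) = b i" by linarith
  qed
  with y z show thesis by (rule that)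
qed

text \<open>Weak duality and complementary slackness are read off from this splitting into a dual
  value and reduced costs.\<close>

lemma cost_gap:
  assumes "ip_feasible A d n b v"
  shows "(\<Sum>j<n. c j * real (v j)) = y \<bullet> emb d (\<lambda>i. real_of_int (b i)) + (\<Sum>j<n. (c j - y \<bullet> col j) * real (v j))"
  unfolding ip_feasible_comb[OF assms, symmetric] inner_comb
  by (simp add: algebra_simps sum.distrib[symmetric])

text \<open>Any other optimal solution has vanishing total reduced cost too, so it lives on the same
  face, and independence identifies the two.\<close>

lemma unimodular_generic:
  assumes gen: "generic c" and uni: "\<And>y. feas c y \<Longrightarrow> frac_pts (tight c y) = {}"
  shows "generic_cost A d n c"
  unfolding generic_cost_def
proof (intro conjI allI impI generic_triangulation[OF gen])
  fix b assume "in_NA A d n b"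
  then obtain y u where y: "feas c y" and u: "\<And>j. j \<notin> tight c y \<Longrightarrow> u j = 0" "ip_feasible A d n b u"
    using integral_solution[OF uni] by metis
  define g where "g = y \<bullet> emb d (\<lambda>i. real_of_int (b i))"
  have zero: "(c j - y \<bullet> col j) * real (u j) = 0" if "j < n" for j
    using u(1)[of j] that by (cases "j \<in> tight c y") (simp_all add: tight_def)
  have "(\<Sum>j<n. (c j - y \<bullet> col j) * real (u j)) = 0"
    by (intro sum.neutral ballI) (metis zero lessThan_iff)
  then have cu: "(\<Sum>j<n. c j * real (u j)) = g" unfolding cost_gap[OF u(2), of c y] g_def by simp
  have nn: "0 \<le> (c j - y \<bullet> col j) * real (v j)" if "j < n" for j and v :: "nat \<Rightarrow> nat"
    using y that by (simp add: feas_def)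
  have ge: "g \<le> (\<Sum>j<n. c j * real (v j))" if "ip_feasible A d n b v" for v
  proof -
    have "0 \<le> (\<Sum>j<n. (c j - y \<bullet> col j) * real (v j))" by (intro sum_nonneg nn) simp
    then show ?thesis unfolding cost_gap[OF that, of c y] g_def by simp
  qed
  show "\<exists>!u. ip_optimal A d n c b u"
  proof (rule ex1I[of _ u])
    show "ip_optimal A d n c b u" unfolding ip_optimal_def using u(2) cu ge by simp
    fix v assume v: "ip_optimal A d n c b v"
    then have fv: "ip_feasible A d n b v" and "(\<Sum>j<n. c j * real (v j)) \<le> g"
      using u(2) cu unfolding ip_optimal_def by auto
    then have "(\<Sum>j<n. (c j - y \<bullet> col j) * real (v j)) \<le> 0"
      unfolding cost_gap[OF fv, of c y] g_def by simp
    then have "(\<Sum>j<n. (c j - y \<bullet> col j) * real (v j)) = 0" by (intro antisym sum_nonneg nn) simp_all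
    moreover have "(\<Sum>j<n. (c j - y \<bullet> col j) * real (v j)) = 0 \<longleftrightarrow>
        (\<forall>j\<in>{..<n}. (c j - y \<bullet> col j) * real (v j) = 0)"
      using nn by (intro sum_nonneg_eq_0_iff) auto
    ultimately have v0: "\<forall>j\<in>{..<n}. (c j - y \<bullet> col j) * real (v j) = 0" by blast
    have "supp_in (\<lambda>j. real (v j)) (tight c y)"
      unfolding supp_in_def
    proof (intro allI impI)
      fix j assume j: "j \<notin> tight c y"
      show "real (v j) = 0"
      proof (cases "j < n")
        case True
        then have "c j - y \<bullet> col j \<noteq> 0" using j by (simp add: tight_def)
        moreover have "(c j - y \<bullet> col j) * real (v j) = 0" using v0 True by blast
        ultimately show ?thesis by simp
      next
        case False
        then show ?thesis using fv by (simp add: ip_feasible_def)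
      qed
    qed
    moreover have "supp_in (\<lambda>j. real (u j)) (tight c y)" using u(1) by (simp add: supp_in_def)
    moreover have "comb (\<lambda>j. real (v j)) = comb (\<lambda>j. real (u j))"
      using ip_feasible_comb[OF fv] ip_feasible_comb[OF u(2)] by simp
    moreover have "indep (tight c y)" using gen y by (simp add: generic_def)
    ultimately have "(\<lambda>j. real (v j)) = (\<lambda>j. real (u j))" using indep_unique by blast
    then show "v = u" by (metis of_nat_eq_iff ext)
  qed
qed

text \<open>Shows that \<open>dual_sigma\<close> is well defined: the difference to another solution
  would, by full rank, be non-zero on some column, and \<open>face_extend\<close> would enlarge the
  maximal face.\<close>

lemma maximal_dual:
  assumes max: "maximal_face (Delta A d n c) (tight c y)" and y: "feas c y"
  shows "colprod A d (dual_sigma A d c (tight c y)) j = y \<bullet> col j"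
proof -
  let ?\<sigma> = "tight c y"
  define z where "z = (\<lambda>i. if i < d then unemb y i else 0)"
  have cz: "colprod A d z j = y \<bullet> col j" for j
    unfolding inner_col by (simp add: colprod_def z_def)
  have "dual_sigma A d c ?\<sigma> = z"
    unfolding dual_sigma_def
  proof (rule the_equality)
    show "(\<forall>i\<ge>d. z i = 0) \<and> (\<forall>j\<in>?\<sigma>. colprod A d z j = c j)"
      unfolding cz by (auto simp: z_def tight_def)
    fix z' assume z': "(\<forall>i\<ge>d. z' i = 0) \<and> (\<forall>j\<in>?\<sigma>. colprod A d z' j = c j)"
    define w where "w = emb d z' - emb d z"
    have wj: "w \<bullet> col j = colprod A d z' j - colprod A d z j" for j
      by (simp add: w_def inner_diff_left colprod_eq)
    have "\<forall>k<n. w \<bullet> col k = 0"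
    proof (rule ccontr)
      assume "\<not> ?thesis"
      then obtain k where k: "k < n" "w \<bullet> col k \<noteq> 0" by blast
      have "w \<bullet> col j = 0" if "j \<in> ?\<sigma>" for j
        using that z' unfolding wj cz by (auto simp: tight_def)
      then obtain y' where "feas c y'" "?\<sigma> \<subset> tight c y'" using face_extend[OF y _ k] by metis
      moreover then have "tight c y' \<in> Delta A d n c" unfolding Delta_iff by blast
      ultimately show False using max unfolding maximal_face_def by blast
    qed
    then have "\<forall>j<n. colprod A d (\<lambda>i. z' i - z i) j = 0"
      unfolding wj by (simp add: colprod_def left_diff_distrib sum_subtractf)
    then have "\<forall>i<d. z' i - z i = 0" using rank unfolding full_row_rank_def by blast
    then show "z' = z" using z' by (intro ext) (metis eq_iff_diff_eq_0 not_le z_def)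
  qed
  then show ?thesis by (simp add: cz)
qed

text \<open>Take a maximal face containing the support of the integral solution: it has group
  objective 0 there, and the reduced costs off the face are non-negative.\<close>

lemma unimodular_gomory:
  assumes uni: "\<And>y. feas c y \<Longrightarrow> frac_pts (tight c y) = {}"
  shows "gomory_family A d n c"
  unfolding gomory_family_def
proof (intro allI impI)
  fix b assume "in_NA A d n b"
  then obtain y u where y: "feas c y" and u: "\<And>j. j \<notin> tight c y \<Longrightarrow> u j = 0" "ip_feasible A d n b u"
    using integral_solution[OF uni] by metis
  have "Delta A d n c \<subseteq> Pow {..<n}" by (auto simp: Delta_def)
  then have "finite (Delta A d n c)" by (rule finite_subset) simp
  moreover have "tight c y \<in> Delta A d n c" unfolding Delta_iff using y by blast
  ultimately obtain \<tau> where \<tau>: "\<tau> \<in> Delta A d n c" "tight c y \<subseteq> \<tau>"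
    and "\<And>\<rho>. \<rho> \<in> Delta A d n c \<Longrightarrow> \<tau> \<subseteq> \<rho> \<Longrightarrow> \<tau> = \<rho>"
    using finite_has_maximal2[of "Delta A d n c" "tight c y"] by metis
  then have max: "maximal_face (Delta A d n c) \<tau>" unfolding maximal_face_def by blast
  obtain y' where y': "feas c y'" "tight c y' = \<tau>" using \<tau>(1) unfolding Delta_iff by blast
  have red: "reduced_cost A d c \<tau> j = c j - y' \<bullet> col j" for j
    using maximal_dual[of c y' j] max y' by (simp add: reduced_cost_def)
  have "group_optimal A d n c \<tau> b (\<lambda>j. int (u j))"
    unfolding group_optimal_def
  proof (intro conjI allI impI)
    show "group_feasible A d n \<tau> b (\<lambda>j. int (u j))"
      using u(2) by (simp add: group_feasible_def ip_feasible_def)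
    fix x' assume x': "group_feasible A d n \<tau> b x'"
    have "group_obj A d n c \<tau> (\<lambda>j. int (u j)) = 0"
      unfolding group_obj_def
    proof (rule sum.neutral, rule ballI)
      fix j assume "j \<in> {..<n} - \<tau>"
      then have "u j = 0" using u(1)[of j] \<tau>(2) by blast
      then show "reduced_cost A d c \<tau> j * real_of_int (int (u j)) = 0" by simp
    qed
    also have "0 \<le> group_obj A d n c \<tau> x'"
      unfolding group_obj_def red using x' y'(1)
      by (intro sum_nonneg mult_nonneg_nonneg) (auto simp: group_feasible_def feas_def)
    finally show "group_obj A d n c \<tau> (\<lambda>j. int (u j)) \<le> group_obj A d n c \<tau> x'" .
  qed
  then have "group_solves A d n c \<tau> b" unfolding group_solves_def by (intro exI[of _ "\<lambda>j. int (u j)"]) simp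
  then show "\<exists>\<sigma>. maximal_face (Delta A d n c) \<sigma> \<and> group_solves A d n c \<sigma> b" using max by (intro exI[of _ \<tau>] conjI)
qed

end

theorem theorem5p2:
  fixes A :: "nat \<Rightarrow> nat \<Rightarrow> int" and d n :: nat
  assumes rank: "full_row_rank A d n"
    and pointed: "pointed_cone A d n"
    and kernel: "\<forall>x :: nat \<Rightarrow> real. (\<forall>j<n. 0 \<le> x j) \<and> (\<forall>i<d. (\<Sum>j<n. real_of_int (A i j) * x j) = 0)
                   \<longrightarrow> (\<forall>j<n. x j = 0)"
    and lattice: "lattice_full A d n"
    and normal: "normal_config A d n"
    and d3: "d \<le> 3"
  shows "\<exists>c :: nat \<Rightarrow> int. generic_cost A d n (\<lambda>j. real_of_int (c j))
            \<and> gomory_family A d n (\<lambda>j. real_of_int (c j))"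
proof -
  interpret normal_matrix A d n by standard (fact rank kernel normal d3)+
  obtain c :: "nat \<Rightarrow> int" where "generic (\<lambda>j. real_of_int (c j))"
    "\<And>y. feas (\<lambda>j. real_of_int (c j)) y \<Longrightarrow> frac_pts (tight (\<lambda>j. real_of_int (c j)) y) = {}"
    using unimodular_int_cost by metis
  then show ?thesis using unimodular_generic unimodular_gomory by blast
qed

end
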